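(* Let $\pi$ be the prior on $p\times p$ covariance matrices defined by $\pi(\Sigma)=\pi^u(\Sigma)I(\Sigma\in\mathcal{U}(\tau))/\pi^u(\Sigma\in\mathcal{U}(\tau))$, where $\mathcal{U}(\tau)=\{\Sigma\in\mathcal{C}_p:\tau^{-1}\le\lambda_{\min}(\Sigma)\le\lambda_{\max}(\Sigma)\le\tau\}$ and $\pi^u$ is the prior on symmetric matrices under which, independently, for $1\le j<k\le p$: $\sigma_{kj}=\sigma_{jk}$, $\sigma_{jk}\mid\rho_{jk}\sim N\big(0,\frac{\rho_{jk}}{1-\rho_{jk}}\tau_1^2\big)$, $\rho_{jk}\sim\mathrm{Beta}(a,b)$, and for $j=1,\ldots,p$: $\sigma_{jj}\sim\mathrm{Gamma}(1,\lambda/2)$ (shape $1$, rate $\lambda/2$). For a fixed $\Sigma_0$ and $\epsilon>0$ let $$B_\epsilon=\{f_\Sigma:\Sigma\in\mathcal{C}_p,\ K(f_{\Sigma_0},f_\Sigma)<\epsilon^2,\ V(f_{\Sigma_0},f_\Sigma)<\epsilon^2\},$$ with $K(f_{\Sigma_0},f_\Sigma)=\int f_{\Sigma_0}\log(f_{\Sigma_0}/f_\Sigma)$ and $V(f_{\Sigma_0},f_\Sigma)=\int f_{\Sigma_0}\big(\log(f_{\Sigma_0}/f_\Sigma)\big)^2$, and let $\epsilon_n=\big((p+s_0)\log p/n\big)^{1/2}$. Assume $\Sigma_0\in\mathcal{U}(s_0,\tau_0)=\{\Sigma\in\mathcal{C}_p:|s(\Sigma)|\le s_0,\ \tau_0^{-1}\le\lambda_{\min}(\Sigma)\le\lambda_{\max}(\Sigma)\le\tau_0\}$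 with $\tau_0<\tau$, $p\asymp n^\beta$ for some $0<\beta<1$, $\tau^4\le p$, $\tau^2\tau_0^2\le s_0\log p$, $n\ge\max\{1/\tau_0^4,\ s_0/(1-\tau_0/\tau)^2\}\log p/\tau^4$, $p^{-1}<\lambda<\log p/\tau_0$, $a=b=1/2$ and $\tau_1^2\asymp1/(np^4\tau^2)$. Then, for all sufficiently large $n$, $$\pi(B_{\epsilon_n})\ge\exp\Big\{-\Big(5+\frac1\beta\Big)n\epsilon_n^2\Big\}.$$
   Context: $f_\Sigma$ is the density of $N_p(0,\Sigma)$; $\mathcal{C}_p$ is the set of $p\times p$ positive definite matrices; $|s(\Sigma)|$ is the number of nonzero off-diagonal entries; $s_0$ is a positive integer and $\tau_0>1$. $\pi(B_\epsilon)$ is the prior probability that $f_\Sigma\in B_\epsilon$. The quantities $p,s_0,\tau_1$ (and possibly $\tau,\lambda$) depend on the sample size $n$; $a_n\asymp b_n$ means $a_n/b_n$ is bounded above and away from zero. *)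

theory Defs
  imports "HOL-Probability.Probability" "Jordan_Normal_Form.Char_Poly"
    "Jordan_Normal_Form.Gauss_Jordan_Elimination"
begin

definition pos_def_mat :: "nat \<Rightarrow> real mat \<Rightarrow> bool" where
  "pos_def_mat p A \<longleftrightarrow> A \<in> carrier_mat p p \<and> A\<^sup>T = A \<and>
     (\<forall>v \<in> carrier_vec p. v \<noteq> 0\<^sub>v p \<longrightarrow> v \<bullet> (A *\<^sub>v v) > 0)"

(* smallest / largest eigenvalue (the matrices considered are real symmetric) *)
definition lambda_min :: "real mat \<Rightarrow> real" where
  "lambda_min A = Min {k. eigenvalue A k}"
definition lambda_max :: "real mat \<Rightarrow> real" where
  "lambda_max A = Max {k. eigenvalue A k}"

definition U_tau :: "nat \<Rightarrow> real \<Rightarrow> real mat set" where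
  "U_tau p \<tau> = {S. pos_def_mat p S \<and> 1/\<tau> \<le> lambda_min S \<and> lambda_min S \<le> lambda_max S
                     \<and> lambda_max S \<le> \<tau>}"

definition supp_size :: "real mat \<Rightarrow> nat" where
  "supp_size S = card {(i,j). i < dim_row S \<and> j < dim_col S \<and> i \<noteq> j \<and> S $$ (i,j) \<noteq> 0}"

definition U_sparse :: "nat \<Rightarrow> nat \<Rightarrow> real \<Rightarrow> real mat set" where
  "U_sparse p s0 \<tau>0 = {S. pos_def_mat p S \<and> supp_size S \<le> s0 \<and>
      1/\<tau>0 \<le> lambda_min S \<and> lambda_min S \<le> lambda_max S \<and> lambda_max S \<le> \<tau>0}"

definition gauss_dens :: "nat \<Rightarrow> real mat \<Rightarrow> (nat \<Rightarrow> real) \<Rightarrow> real" where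
  "gauss_dens p S x =
     (2 * pi) powr (- real p / 2) * det S powr (-1/2) *
     exp (- 1/2 * (vec p x \<bullet> (the (mat_inverse S) *\<^sub>v vec p x)))"

abbreviation lborel_p :: "nat \<Rightarrow> (nat \<Rightarrow> real) measure" where
  "lborel_p p \<equiv> PiM {..<p} (\<lambda>_. lborel)"

definition KL_gauss :: "nat \<Rightarrow> real mat \<Rightarrow> real mat \<Rightarrow> real" where
  "KL_gauss p S0 S = (\<integral>x. gauss_dens p S0 x * ln (gauss_dens p S0 x / gauss_dens p S x) \<partial>lborel_p p)"
definition V_gauss :: "nat \<Rightarrow> real mat \<Rightarrow> real mat \<Rightarrow> real" where
  "V_gauss p S0 S = (\<integral>x. gauss_dens p S0 x * (ln (gauss_dens p S0 x / gauss_dens p S x))\<^sup>2 \<partial>lborel_p p)"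

(* B_eps, as the set of covariance matrices Sigma whose density f_Sigma lies in B_eps *)
definition B_eps :: "nat \<Rightarrow> real mat \<Rightarrow> real \<Rightarrow> real mat set" where
  "B_eps p S0 \<epsilon> = {S. pos_def_mat p S \<and> KL_gauss p S0 S < \<epsilon>\<^sup>2 \<and> V_gauss p S0 S < \<epsilon>\<^sup>2}"

definition beta_density :: "real \<Rightarrow> real \<Rightarrow> real \<Rightarrow> real" where
  "beta_density a b r = (if 0 < r \<and> r < 1 then r powr (a - 1) * (1 - r) powr (b - 1) / Beta a b else 0)"

definition offdiag_law :: "real \<Rightarrow> real \<Rightarrow> real \<Rightarrow> real measure" where
  "offdiag_law a b \<tau>1 =
     distr (density (lborel \<Otimes>\<^sub>M lborel)
              (\<lambda>(r, s). ennreal (beta_density a b r * normal_density 0 (sqrt (r / (1 - r) * \<tau>1\<^sup>2)) s)))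
           lborel snd"

(* law of a diagonal entry: Gamma(shape 1, rate lambda/2) *)
definition diag_law :: "real \<Rightarrow> real measure" where
  "diag_law lam = density lborel (erlang_density 0 (lam / 2))"

definition prior_u :: "nat \<Rightarrow> real \<Rightarrow> real \<Rightarrow> real \<Rightarrow> real \<Rightarrow> ((nat \<times> nat) \<Rightarrow> real) measure" where
  "prior_u p a b \<tau>1 lam =
     PiM {(j, k). j \<le> k \<and> k < p} (\<lambda>(j, k). if j = k then diag_law lam else offdiag_law a b \<tau>1)"

definition sym_mat :: "nat \<Rightarrow> ((nat \<times> nat) \<Rightarrow> real) \<Rightarrow> real mat" where
  "sym_mat p x = mat p p (\<lambda>(i, j). if i \<le> j then x (i, j) else x (j, i))"

definition prior_prob :: "nat \<Rightarrow> real \<Rightarrow> real \<Rightarrow> real \<Rightarrow> real \<Rightarrow> real \<Rightarrow> real mat set \<Rightarrow> real" where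
  "prior_prob p \<tau> a b \<tau>1 lam A =
     measure (prior_u p a b \<tau>1 lam) {x \<in> space (prior_u p a b \<tau>1 lam). sym_mat p x \<in> A \<inter> U_tau p \<tau>}
     / measure (prior_u p a b \<tau>1 lam) {x \<in> space (prior_u p a b \<tau>1 lam). sym_mat p x \<in> U_tau p \<tau>}"

definition asymp_eq :: "(nat \<Rightarrow> real) \<Rightarrow> (nat \<Rightarrow> real) \<Rightarrow> bool" where
  "asymp_eq a b \<longleftrightarrow> (\<exists>c C. 0 < c \<and>
      eventually (\<lambda>n. b n \<noteq> 0 \<and> c \<le> a n / b n \<and> a n / b n \<le> C) sequentially)"

end

theory Submission
  imports Defs "HOL-Real_Asymp.Real_Asymp"
begin

text \<open>
  For positive densities $f$, $g$ one has $\log(f/g) \le f/g - 1$ and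
  $(\log(f/g))^2 \le 2(f/g + g/f - 2)$, so $K$ and $V$ are bounded by once resp. twice the chi-square
  divergence $\chi^2 = \int f^2/g - 1$. For $f = f_{\Sigma_0}$, $g = f_\Sigma$, $E = \Sigma - \Sigma_0$ and
  $M = \Sigma - E\Sigma^{-1}E$ the Gaussian integral gives $1 + \chi^2 = (\det\Sigma/\det M)^{1/2}$,
  because $2\Sigma_0^{-1} - \Sigma^{-1} = \Sigma_0^{-1}M\Sigma_0^{-1}$. If the operator norm of $E$ is of order
  $n^{-1/2}$, then $M \ge (1 - O(1/n))\Sigma$, hence $\det M \ge (1 - O(1/n))^p\det\Sigma$ and
  $\chi^2 = O(p/n)$, which is below $\epsilon_n^2$. The eigenvalue constraint survives because
  $1 - \tau_0/\tau$ is at least of order $n^{-1/2}$.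

  It therefore suffices to bound the prior mass of a box with sides of order $n^{-1/2}$ on the diagonal
  and $p^{-1}n^{-1/2}$ off it. An off-diagonal entry has marginal density of order $\tau_1/s^2$ away
  from $0$: this makes each of the at most $p^2$ zero entries stay in its interval with probability
  $1 - O(1/p)$, at total cost $e^{-O(p)}$, while a nonzero entry and a diagonal entry each cost only a
  power of $p$ with exponent below $5 + 1/\beta$.
\<close>

section \<open>The Gaussian integral\<close>

text \<open>Chi-square is the convenient divergence because it rests on one analytic fact, the
  Gaussian integral of a quadratic form. That integral normalises the densities, evaluates the
  divergence and even compares determinants, so neither a diagonalisation nor moments of a Gaussian
  vector occur. The rate 5 + 1/\<beta> is a budget in powers of p, where p \<asymp> n^\<beta> gives
  n \<le> K p^(1/\<beta>). For a nonzero entry, the width of order 1/(p sqrt n) meets a density of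
  order |\<tau>1|, hence at least of order 1/(sqrt n p^3) because \<tau> \<le> p. The product 1/(n
  p^4) costs 4 + 1/\<beta>, and the last power of p swallows the constants. A diagonal entry is
  charged only 4 + 1/\<beta>; the power saved on each of the p diagonal entries pays for all zero
  entries together. A second difficulty is that \<tau> may vary with n, both towards \<tau>0 and
  towards infinity, so the room left by the eigenvalue constraint has to be found in two
  regimes.\<close>

definition qf :: "nat \<Rightarrow> real mat \<Rightarrow> (nat \<Rightarrow> real) \<Rightarrow> real" where
  "qf p A v = (\<Sum>i<p. \<Sum>j<p. A $$ (i, j) * v i * v j)"

lemma scalar_prod_mult_mat_vec_eq_qf:
  assumes "A \<in> carrier_mat p p"
  shows "vec p v \<bullet> (A *\<^sub>v vec p v) = qf p A v"
  using assms
  by (auto simp: scalar_prod_def qf_def sum_distrib_left lessThan_atLeast0 ac_simps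
      intro!: sum.cong)

text \<open>The definition speaks of vectors of the matrix library, the integrals of functions on
  the naturals, which are the points of \<open>lborel_p p\<close>. From here on vectors are such
  functions, of which only the coordinates below \<open>p\<close> matter; hence nonzeroness is
  tested there.\<close>

lemma pos_def_mat_iff_qf:
  "pos_def_mat p A \<longleftrightarrow> A \<in> carrier_mat p p \<and> (\<forall>i<p. \<forall>j<p. A $$ (i, j) = A $$ (j, i)) \<and>
     (\<forall>v. (\<exists>i<p. v i \<noteq> 0) \<longrightarrow> qf p A v > 0)"
proof (cases "A \<in> carrier_mat p p")
  case True
  have 1: "A\<^sup>T = A \<longleftrightarrow> (\<forall>i<p. \<forall>j<p. A $$ (i, j) = A $$ (j, i))"
  proof
    assume "A\<^sup>T = A"
    then show "\<forall>i<p. \<forall>j<p. A $$ (i, j) = A $$ (j, i)"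
      using True by (metis carrier_matD index_transpose_mat(1))
  qed (use True in \<open>auto intro!: eq_matI\<close>)
  have "(\<forall>v \<in> carrier_vec p. v \<noteq> 0\<^sub>v p \<longrightarrow> v \<bullet> (A *\<^sub>v v) > 0) \<longleftrightarrow>
        (\<forall>f. vec p f \<noteq> 0\<^sub>v p \<longrightarrow> vec p f \<bullet> (A *\<^sub>v vec p f) > 0)"
  proof -
    have "v = vec p (\<lambda>i. v $ i)" if "v \<in> carrier_vec p" for v :: "real vec"
      using that by auto
    then show ?thesis by (metis vec_carrier)
  qed
  also have "\<dots> \<longleftrightarrow> (\<forall>v. (\<exists>i<p. v i \<noteq> 0) \<longrightarrow> qf p A v > 0)"
  proof -
    have "vec p f \<noteq> 0\<^sub>v p \<longleftrightarrow> (\<exists>i<p. f i \<noteq> 0)" for f :: "nat \<Rightarrow> real"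
      by (auto simp: vec_eq_iff)
    then show ?thesis using True by (simp add: scalar_prod_mult_mat_vec_eq_qf)
  qed
  finally show ?thesis using 1 True by (simp add: pos_def_mat_def)
qed (simp add: pos_def_mat_def)

lemma pos_def_mat_carrier: "pos_def_mat p A \<Longrightarrow> A \<in> carrier_mat p p"
  by (simp add: pos_def_mat_def)

section \<open>Schur complements and the Gaussian integral in p dimensions\<close>

definition schur_compl :: "nat \<Rightarrow> real mat \<Rightarrow> real mat" where
  "schur_compl p A = mat p p (\<lambda>(i, j). A $$ (i, j) - A $$ (i, p) * A $$ (p, j) / A $$ (p, p))"

text \<open>Block elimination with the last diagonal entry as pivot: \<open>A\<close> is a block
  upper triangular matrix with unit diagonal times a block lower triangular one with diagonal blocks
  \<open>S\<close> and \<open>C\<close>.\<close>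

lemma det_schur_compl:
  assumes A: "A \<in> carrier_mat (Suc p) (Suc p)" and c: "A $$ (p, p) \<noteq> 0"
  shows "det A = A $$ (p, p) * det (schur_compl p A)"
proof -
  let ?c = "A $$ (p, p)"
  define U where "U = mat p 1 (\<lambda>(i, j). A $$ (i, p) / ?c)"
  define L where "L = mat 1 p (\<lambda>(i, j). A $$ (p, j))"
  define C where "C = mat 1 1 (\<lambda>_. ?c)"
  define S where "S = schur_compl p A"
  have UC: "U \<in> carrier_mat p 1" and LC: "L \<in> carrier_mat 1 p"
    and CC: "C \<in> carrier_mat 1 1" and SC: "S \<in> carrier_mat p p"
    by (auto simp: U_def L_def C_def S_def schur_compl_def)
  let ?X = "four_block_mat (1\<^sub>m p) U (0\<^sub>m 1 p) (1\<^sub>m 1)"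
  let ?Y = "four_block_mat S (0\<^sub>m p 1) L C"
  have "?X * ?Y = four_block_mat (1\<^sub>m p * S + U * L) (1\<^sub>m p * 0\<^sub>m p 1 + U * C)
      (0\<^sub>m 1 p * S + 1\<^sub>m 1 * L) (0\<^sub>m 1 p * 0\<^sub>m p 1 + 1\<^sub>m 1 * C)"
    by (rule mult_four_block_mat[OF one_carrier_mat UC zero_carrier_mat one_carrier_mat
        SC zero_carrier_mat LC CC])
  also have "\<dots> = A"
    using A c
    by (intro eq_matI)
      (auto simp: U_def L_def C_def S_def schur_compl_def scalar_prod_def less_Suc_eq)
  finally have "det A = det ?X * det ?Y"
    using det_mult[of ?X "p + 1" ?Y]
    by (metis four_block_carrier_mat one_carrier_mat
       CC SC)
  moreover have "det ?X = 1"
    by (subst det_four_block_mat_lower_left_zero[OF one_carrier_mat UC _ one_carrier_mat]) auto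
  moreover have "det ?Y = det S * det C"
    by (subst det_four_block_mat_upper_right_zero[OF SC _ LC CC]) auto
  moreover have "det C = ?c"
    by (subst det_single) (auto simp: C_def)
  ultimately show ?thesis by (simp add: S_def)
qed

text \<open>Completing the square in the last variable; symmetry merges the last row and the last
  column into one cross term.\<close>

lemma qf_schur_compl:
  assumes sym: "\<forall>i<Suc p. \<forall>j<Suc p. A $$ (i, j) = A $$ (j, i)" and c: "A $$ (p, p) \<noteq> 0"
  shows "qf (Suc p) A v = qf p (schur_compl p A) v +
    A $$ (p, p) * (v p + (\<Sum>i<p. A $$ (i, p) * v i) / A $$ (p, p))\<^sup>2"
proof -
  let ?c = "A $$ (p, p)"
  define b where "b = (\<Sum>i<p. A $$ (i, p) * v i)"
  have b': "(\<Sum>j<p. A $$ (p, j) * v j) = b"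
    using sym by (auto simp: b_def intro!: sum.cong)
  have "qf p (schur_compl p A) v = (\<Sum>i<p. \<Sum>j<p. A $$ (i, j) * v i * v j -
      (A $$ (i, p) * v i) * (A $$ (p, j) * v j) / ?c)"
    by (auto simp: qf_def schur_compl_def algebra_simps intro!: sum.cong)
  also have "\<dots> = qf p A v - b * b / ?c"
    unfolding qf_def sum_subtractf
    by (simp add: sum_divide_distrib[symmetric] sum_distrib_left[symmetric]
        sum_distrib_right[symmetric] b' b_def[symmetric] flip: b')
  finally have 1: "qf p (schur_compl p A) v = qf p A v - b * b / ?c" .
  have "(\<Sum>i<p. A $$ (i, p) * v i * v p) = b * v p"
    by (simp add: b_def sum_distrib_right)
  moreover have "(\<Sum>j<p. A $$ (p, j) * v p * v j) = b * v p"
    unfolding b'[symmetric] by (auto simp: sum_distrib_right intro!: sum.cong)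
  ultimately have "qf (Suc p) A v = qf p A v + 2 * b * v p + ?c * v p * v p"
    by (simp add: qf_def sum.distrib)
  moreover have "?c * (v p + b / ?c)\<^sup>2 = 2 * b * v p + ?c * v p * v p + b * b / ?c"
    using c by (simp add: power2_eq_square field_simps)
  ultimately show ?thesis
    unfolding b_def[symmetric] using 1 by linarith
qed

lemma pos_def_mat_diag_pos:
  assumes "pos_def_mat p A" "i < p"
  shows "A $$ (i, i) > 0"
proof -
  let ?v = "\<lambda>j. if j = i then 1 else 0 :: real"
  have "qf p A ?v = (\<Sum>k<p. if k = i then A $$ (i, i) else 0)"
    unfolding qf_def by (intro sum.cong) (auto simp: if_distrib \<open>i < p\<close> cong: if_cong)
  with assms show ?thesis
    unfolding pos_def_mat_iff_qf by (auto dest!: spec[of _ ?v] simp: exI[of _ i])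
qed

lemma pos_def_schur_compl:
  assumes "pos_def_mat (Suc p) A"
  shows "pos_def_mat p (schur_compl p A)"
proof -
  have c: "A $$ (p, p) > 0" using pos_def_mat_diag_pos[OF assms] by simp
  have sym: "\<forall>i<Suc p. \<forall>j<Suc p. A $$ (i, j) = A $$ (j, i)"
    using assms pos_def_mat_iff_qf by blast
  have "qf p (schur_compl p A) v > 0" if "i < p" "v i \<noteq> 0" for v i
  proof -
    \<comment> \<open>The last coordinate is chosen to annihilate the completed square, so that the
      form of \<open>A\<close> at \<open>w\<close> is that of the Schur complement.\<close>
    define w where "w = v(p := - (\<Sum>i<p. A $$ (i, p) * v i) / A $$ (p, p))"
    have "\<exists>i<Suc p. w i \<noteq> 0" using that by (intro exI[of _ i]) (auto simp: w_def)
    then have "qf (Suc p) A w > 0"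
      using assms pos_def_mat_iff_qf by blast
    moreover have "(\<Sum>i<p. A $$ (i, p) * w i) = (\<Sum>i<p. A $$ (i, p) * v i)"
      by (auto simp: w_def intro!: sum.cong)
    ultimately have "qf p (schur_compl p A) w > 0"
      using c by (subst (asm) qf_schur_compl[OF sym]) (auto simp: w_def)
    also have "qf p (schur_compl p A) w = qf p (schur_compl p A) v"
      by (auto simp: w_def qf_def intro!: sum.cong)
    finally show ?thesis .
  qed
  then show ?thesis
    using sym by (auto simp: pos_def_mat_iff_qf) (auto simp: schur_compl_def)
qed

lemma nn_integral_gauss_1d:
  assumes "c > 0"
  shows "(\<integral>\<^sup>+t. ennreal (exp (- 1/2 * (c * (t + m)\<^sup>2))) \<partial>lborel) = ennreal (sqrt (2 * pi / c))"
proof -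
  have *: "exp (- 1/2 * (c * (t + m)\<^sup>2)) =
      sqrt (2 * pi / c) * normal_density (- m) (1 / sqrt c) t" for t
    using assms unfolding normal_density_def
    by (simp add: power_divide real_sqrt_divide real_sqrt_mult field_simps)
  have "(\<integral>\<^sup>+t. ennreal (exp (- 1/2 * (c * (t + m)\<^sup>2))) \<partial>lborel) =
     ennreal (sqrt (2 * pi / c)) * (\<integral>\<^sup>+t. ennreal (normal_density (- m) (1 / sqrt c) t) \<partial>lborel)"
    unfolding * using assms by (simp add: ennreal_mult nn_integral_cmult)
  also have "(\<integral>\<^sup>+t. ennreal (normal_density (- m) (1 / sqrt c) t) \<partial>lborel) = 1"
    using assms by (subst nn_integral_eq_integral) auto
  finally show ?thesis by simp
qed

lemma measurable_qf[measurable]: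
  assumes [measurable]: "\<And>i j. i < p \<Longrightarrow> j < p \<Longrightarrow> (\<lambda>x. A x $$ (i, j)) \<in> borel_measurable M"
    and [measurable]: "\<And>i. i < p \<Longrightarrow> (\<lambda>x. v x i) \<in> borel_measurable M"
  shows "(\<lambda>x. qf p (A x) (v x)) \<in> borel_measurable M"
  unfolding qf_def by (intro borel_measurable_sum borel_measurable_times) auto

lemma measurable_qf_lborel:
  "qf p A \<in> borel_measurable (PiM {..<p} (\<lambda>_. lborel))"
  using measurable_qf[of p "\<lambda>_. A" _ "\<lambda>v. v"] by simp

lemma powr_minus_half:
  fixes x :: real
  assumes "x > 0"
  shows "x powr (-1/2) = 1 / sqrt x"
proof -
  have "x powr (-1/2) = x powr (- (1/2))"
    by (rule arg_cong[of _ _ "\<lambda>t. x powr t"]) simp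
  also have "\<dots> = 1 / x powr (1/2)" by (rule powr_minus_divide)
  also have "\<dots> = 1 / sqrt x" using assms by (subst powr_half_sqrt) auto
  finally show ?thesis .
qed

lemma gauss_normalization_Suc:
  fixes c d :: real
  assumes c: "c > 0" and d: "d > 0"
  shows "(2 * pi) powr (real p / 2) * d powr (-1/2) * sqrt (2 * pi / c) =
     (2 * pi) powr (real (Suc p) / 2) * (c * d) powr (-1/2)"
proof -
  have "(2 * pi) powr (real (Suc p) / 2) = (2 * pi) powr (real p / 2) * (2 * pi) powr (1/2)"
    by (subst powr_add[symmetric]) (simp add: add_divide_distrib add.commute)
  also have "(2 * pi) powr (1/2) = sqrt (2 * pi)"
    by (rule powr_half_sqrt) simp
  finally have 1: "(2 * pi) powr (real (Suc p) / 2) = (2 * pi) powr (real p / 2) * sqrt (2 * pi)" .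
  have 2: "(c * d) powr (-1/2) = c powr (-1/2) * d powr (-1/2)"
    by (rule powr_mult)
  have 3: "c powr (-1/2) = 1 / sqrt c" using c by (rule powr_minus_half)
  show ?thesis unfolding 1 2 3 by (simp add: real_sqrt_divide)
qed

text \<open>Induction on the dimension, integrating out the last coordinate: with the others fixed,
  the completed square contributes sqrt(2 pi / c) whatever its shift, and the form of the Schur
  complement remains. Positivity of the determinant, a product of pivots, travels through the same
  induction.\<close>

lemma gauss_integral:
  assumes "pos_def_mat p A"
  shows "det A > 0 \<and> (\<integral>\<^sup>+x. ennreal (exp (- 1/2 * qf p A x)) \<partial>lborel_p p) =
    ennreal ((2 * pi) powr (real p / 2) * det A powr (-1/2))"
  using assms
proof (induction p arbitrary: A)
  case 0
  then have "det A = 1" by (simp add: pos_def_mat_def)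
  then show ?case
    by (simp add: PiM_empty qf_def nn_integral_count_space_finite)
next
  case (Suc p)
  interpret product_sigma_finite "\<lambda>_::nat. lborel :: real measure" by standard
  let ?S = "schur_compl p A" and ?c = "A $$ (p, p)"
  have c: "?c > 0" using pos_def_mat_diag_pos[OF Suc.prems] by simp
  have sym: "\<forall>i<Suc p. \<forall>j<Suc p. A $$ (i, j) = A $$ (j, i)" and A: "A \<in> carrier_mat (Suc p) (Suc p)"
    using Suc.prems pos_def_mat_iff_qf by blast+
  note S = Suc.IH[OF pos_def_schur_compl[OF Suc.prems]]
  have det: "det A = ?c * det ?S"
    using det_schur_compl[OF A] c by simp
  have q: "qf (Suc p) A (x(p := t)) = qf p ?S x + ?c * (t + (\<Sum>i<p. A $$ (i, p) * x i) / ?c)\<^sup>2"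
    for x t
  proof -
    have "qf p ?S (x(p := t)) = qf p ?S x" by (auto simp: qf_def intro!: sum.cong)
    moreover have "(\<Sum>i<p. A $$ (i, p) * (x(p := t)) i) = (\<Sum>i<p. A $$ (i, p) * x i)"
      by (auto intro!: sum.cong)
    ultimately show ?thesis using c by (subst qf_schur_compl[OF sym]) auto
  qed
  have [measurable]: "qf p ?S \<in> borel_measurable (PiM {..<p} (\<lambda>_. lborel))"
    by (rule measurable_qf_lborel)
  have "(\<integral>\<^sup>+x. ennreal (exp (- 1/2 * qf (Suc p) A x)) \<partial>lborel_p (Suc p)) =
      (\<integral>\<^sup>+x. \<integral>\<^sup>+t. ennreal (exp (- 1/2 * qf (Suc p) A (x(p := t)))) \<partial>lborel \<partial>lborel_p p)"
    unfolding lessThan_Suc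
    using measurable_qf_lborel[of "Suc p" A] unfolding lessThan_Suc
    by (intro product_nn_integral_insert) auto
  also have "\<dots> = (\<integral>\<^sup>+x. ennreal (exp (- 1/2 * qf p ?S x)) * ennreal (sqrt (2 * pi / ?c)) \<partial>lborel_p p)"
  proof (intro nn_integral_cong)
    fix x
    have "(\<integral>\<^sup>+t. ennreal (exp (- 1/2 * qf (Suc p) A (x(p := t)))) \<partial>lborel) =
      (\<integral>\<^sup>+t. ennreal (exp (- 1/2 * qf p ?S x)) *
        ennreal (exp (- 1/2 * (?c * (t + (\<Sum>i<p. A $$ (i, p) * x i) / ?c)\<^sup>2))) \<partial>lborel)"
      unfolding q by (simp add: ennreal_mult[symmetric] exp_add[symmetric] algebra_simps)
    then show "(\<integral>\<^sup>+t. ennreal (exp (- 1/2 * qf (Suc p) A (x(p := t)))) \<partial>lborel) =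
      ennreal (exp (- 1/2 * qf p ?S x)) * ennreal (sqrt (2 * pi / ?c))"
      using nn_integral_gauss_1d[OF c] by (simp add: nn_integral_cmult)
  qed
  also have "\<dots> = ennreal ((2 * pi) powr (real p / 2) * det ?S powr (-1/2)) * ennreal (sqrt (2 * pi / ?c))"
    using S by (simp add: nn_integral_multc)
  also have "\<dots> = ennreal ((2 * pi) powr (real p / 2) * det ?S powr (-1/2) * sqrt (2 * pi / ?c))"
    using c by (simp add: ennreal_mult[symmetric])
  also have "(2 * pi) powr (real p / 2) * det ?S powr (-1/2) * sqrt (2 * pi / ?c) =
     (2 * pi) powr (real (Suc p) / 2) * det A powr (-1/2)"
    unfolding det by (rule gauss_normalization_Suc) (use S c in auto)
  finally show ?case using S c det by simp
qed

section \<open>Quadratic forms and extreme eigenvalues\<close>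

definition nsq :: "nat \<Rightarrow> (nat \<Rightarrow> real) \<Rightarrow> real" where
  "nsq p v = (\<Sum>i<p. (v i)\<^sup>2)"

definition mv :: "nat \<Rightarrow> real mat \<Rightarrow> (nat \<Rightarrow> real) \<Rightarrow> nat \<Rightarrow> real" where
  "mv p A v i = (\<Sum>j<p. A $$ (i, j) * v j)"

definition dot :: "nat \<Rightarrow> (nat \<Rightarrow> real) \<Rightarrow> (nat \<Rightarrow> real) \<Rightarrow> real" where
  "dot p u v = (\<Sum>i<p. u i * v i)"

definition sym_on :: "nat \<Rightarrow> real mat \<Rightarrow> bool" where
  "sym_on p A \<longleftrightarrow> A \<in> carrier_mat p p \<and> (\<forall>i<p. \<forall>j<p. A $$ (i, j) = A $$ (j, i))"

lemma pos_def_mat_sym_on: "pos_def_mat p A \<Longrightarrow> sym_on p A"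
  by (simp add: pos_def_mat_iff_qf sym_on_def)

lemma qf_eq_dot: "qf p A v = dot p v (mv p A v)"
  by (simp add: qf_def dot_def mv_def sum_distrib_left ac_simps)

lemma nsq_eq_dot: "nsq p v = dot p v v"
  by (simp add: nsq_def dot_def power2_eq_square)

lemma nsq_nonneg: "nsq p v \<ge> 0"
  by (simp add: nsq_def sum_nonneg)

lemma nsq_eq_0_iff: "nsq p v = 0 \<longleftrightarrow> (\<forall>i<p. v i = 0)"
  by (auto simp: nsq_def sum_nonneg_eq_0_iff)

lemma dot_cong: "(\<And>i. i < p \<Longrightarrow> u i = u' i) \<Longrightarrow> (\<And>i. i < p \<Longrightarrow> v i = v' i) \<Longrightarrow> dot p u v = dot p u' v'"
  by (simp add: dot_def)

lemma dot_commute: "dot p u v = dot p v u"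
  by (simp add: dot_def mult.commute)

lemma dot_diff_left: "dot p (\<lambda>i. u i - v i) w = dot p u w - dot p v w"
  by (simp add: dot_def sum_subtractf algebra_simps)

lemma dot_diff_right: "dot p w (\<lambda>i. u i - v i) = dot p w u - dot p w v"
  by (simp add: dot_def sum_subtractf algebra_simps)

lemma dot_add_left: "dot p (\<lambda>i. u i + v i) w = dot p u w + dot p v w"
  by (simp add: dot_def sum.distrib algebra_simps)

lemma dot_add_right: "dot p w (\<lambda>i. u i + v i) = dot p w u + dot p w v"
  by (simp add: dot_def sum.distrib algebra_simps)

lemma dot_scale_left: "dot p (\<lambda>i. c * u i) w = c * dot p u w"
  by (simp add: dot_def sum_distrib_left algebra_simps)

lemma dot_scale_right: "dot p w (\<lambda>i. c * u i) = c * dot p w u"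
  by (simp add: dot_def sum_distrib_left algebra_simps)

lemma mv_diff: "mv p A (\<lambda>i. u i - v i) = (\<lambda>i. mv p A u i - mv p A v i)"
  by (simp add: mv_def fun_eq_iff sum_subtractf algebra_simps)

lemma mv_add: "mv p A (\<lambda>i. u i + v i) = (\<lambda>i. mv p A u i + mv p A v i)"
  by (simp add: mv_def fun_eq_iff sum.distrib algebra_simps)

lemma mv_scale: "mv p A (\<lambda>i. c * u i) = (\<lambda>i. c * mv p A u i)"
  by (simp add: mv_def fun_eq_iff sum_distrib_left algebra_simps)

lemma mv_cong: "(\<And>i. i < p \<Longrightarrow> u i = v i) \<Longrightarrow> mv p A u = mv p A v"
  by (simp add: mv_def fun_eq_iff)

lemma dot_mv_sym: "sym_on p A \<Longrightarrow> dot p u (mv p A v) = dot p (mv p A u) v"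
  unfolding dot_def mv_def sum_distrib_left sum_distrib_right
  by (subst sum.swap) (auto simp: sym_on_def ac_simps intro!: sum.cong)

lemmas dot_simps = dot_diff_left dot_diff_right dot_add_left dot_add_right dot_scale_left
  dot_scale_right mv_diff mv_add mv_scale

lemma mult_mat_vec_eq_mv: "A \<in> carrier_mat p p \<Longrightarrow> A *\<^sub>v vec p v = vec p (mv p A v)"
  by (auto simp: mv_def scalar_prod_def lessThan_atLeast0)

lemma mv_mult:
  assumes "A \<in> carrier_mat p p" "B \<in> carrier_mat p p" "i < p"
  shows "mv p (A * B) v i = mv p A (mv p B v) i"
proof -
  have "vec p (mv p (A * B) v) = vec p (mv p A (mv p B v))"
    using assms by (simp flip: mult_mat_vec_eq_mv)
  with \<open>i < p\<close> show ?thesis by (metis index_vec)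
qed

lemma mv_one: "i < p \<Longrightarrow> mv p (1\<^sub>m p) v i = v i"
proof -
  assume i: "i < p"
  have "mv p (1\<^sub>m p) v i = (\<Sum>j<p. if j = i then v j else 0)"
    unfolding mv_def using i by (intro sum.cong) auto
  then show ?thesis using i by simp
qed

section \<open>Rayleigh quotients and extreme eigenvalues\<close>

lemma compact_cube: "compact {f :: nat \<Rightarrow> real. \<forall>i. f i \<in> (if i < p then {-1..1} else {0})}"
proof -
  \<comment> \<open>Tychonoff. Functions on the naturals carry the product topology, so the cube is
    compact only because the coordinates from \<open>p\<close> on are pinned to 0.\<close>
  have "compactin (product_topology (\<lambda>_. euclidean) UNIV)
      (PiE UNIV (\<lambda>i::nat. if i < p then {-1..1::real} else {0}))"
    by (subst compactin_PiE) auto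
  then show ?thesis
    by (simp add: euclidean_product_topology PiE_UNIV_domain Pi_def)
qed

text \<open>First-order optimality without derivatives: a quadratic that vanishes at 0 and is
  nowhere negative has slope 0 there.\<close>

lemma quadratic_nonneg_linear_coeff:
  fixes b c :: real
  assumes "\<And>t. 2 * t * b + t\<^sup>2 * c \<ge> 0"
  shows "b = 0"
proof (rule ccontr)
  assume b: "b \<noteq> 0"
  define d where "d = \<bar>c\<bar> + 1"
  have d: "d > 0" by (simp add: d_def add_nonneg_pos)
  \<comment> \<open>The minimiser once \<open>c\<close> is replaced by the larger, positive
    \<open>d\<close>; this covers either sign of \<open>c\<close>.\<close>
  define t where "t = - b / d"
  have "2 * t * b + t\<^sup>2 * c \<le> 2 * t * b + t\<^sup>2 * d"
    unfolding d_def by (intro add_left_mono mult_left_mono) auto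
  also have "\<dots> = - (b\<^sup>2 / d)"
    unfolding t_def using d by (simp add: power2_eq_square field_simps)
  also have "\<dots> < 0" using b d by (simp add: divide_pos_pos)
  finally show False using assms[of t] by simp
qed

text \<open>By compactness the form attains its minimum on the unit sphere, and a minimiser is an
  eigenvector. No diagonalisation is involved.\<close>

lemma rayleigh_min:
  assumes sym: "sym_on p A" and p: "p > 0"
  shows "\<exists>k. eigenvalue A k \<and> (\<forall>v. k * nsq p v \<le> qf p A v)"
proof -
  define K where "K = {f :: nat \<Rightarrow> real. \<forall>i. f i \<in> (if i < p then {-1..1} else {0})} \<inter> {f. nsq p f = 1}"
  have "closed {f :: nat \<Rightarrow> real. nsq p f = 1}"
    unfolding nsq_def by (intro closed_Collect_eq continuous_intros continuous_on_product_coordinates)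
  then have K: "compact K" unfolding K_def by (intro compact_Int_closed compact_cube)
  have "nsq p (\<lambda>i. if i = 0 then 1 else 0) = (\<Sum>i<p. if i = 0 then 1 else 0)"
    unfolding nsq_def by (intro sum.cong) auto
  then have "(\<lambda>i. if i = 0 then 1 else 0) \<in> K"
    using p by (auto simp: K_def)
  then have "K \<noteq> {}" by blast
  moreover have "continuous_on K (qf p A)"
    unfolding qf_def
    by (intro continuous_intros continuous_on_subset[OF continuous_on_product_coordinates] subset_UNIV)
  ultimately obtain v where v: "v \<in> K" "\<And>w. w \<in> K \<Longrightarrow> qf p A v \<le> qf p A w"
    using continuous_attains_inf[OF K] by blast
  define m where "m = qf p A v"
  have nv: "nsq p v = 1" using v by (simp add: K_def)
  have min: "m * nsq p w \<le> qf p A w" for w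
  proof (cases "nsq p w = 0")
    case True
    moreover from True have "\<forall>i<p. w i = 0" by (simp only: nsq_eq_0_iff)
    ultimately show ?thesis by (simp add: qf_def)
  next
    case False
    define r where "r = sqrt (nsq p w)"
    have r: "r > 0" "r\<^sup>2 = nsq p w" using False nsq_nonneg[of p w] by (auto simp: r_def)
    define u where "u i = (if i < p then w i / r else 0)" for i
    have wu: "w i = r * u i" if "i < p" for i using that r by (simp add: u_def)
    have nu: "nsq p u = 1"
      using r False by (simp add: nsq_def u_def power_divide sum_divide_distrib[symmetric])
    have "u i \<in> {-1..1}" if "i < p" for i
    proof -
      have "(u i)\<^sup>2 \<le> nsq p u" unfolding nsq_def using that by (intro member_le_sum) auto
      then have "\<bar>u i\<bar> \<le> 1" using nu by (simp add: abs_square_le_1)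
      then show ?thesis by auto
    qed
    then have "u \<in> K" using nu by (auto simp: K_def u_def)
    then have "m \<le> qf p A u" using v(2) by (simp add: m_def)
    moreover have "qf p A w = r\<^sup>2 * qf p A u"
      unfolding qf_def sum_distrib_left by (auto simp: wu power2_eq_square intro!: sum.cong)
    ultimately show ?thesis using r
      by (metis mult.commute mult_left_mono zero_le_power2)
  qed
  \<comment> \<open>The residual of the eigenvector equation. The bound \<open>min\<close> holds for
    all vectors, so \<open>v\<close> may be moved along \<open>w\<close> off the sphere and no
    Lagrange multiplier appears; the linear term in \<open>t\<close> is 2 t |w|^2, which forces the
    residual to vanish.\<close>
  define w where "w i = mv p A v i - m * v i" for i
  have "0 \<le> 2 * t * dot p w w + t\<^sup>2 * (qf p A w - m * nsq p w)" for t
  proof -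
    let ?u = "\<lambda>i. v i + t * w i"
    have "qf p A ?u = qf p A v + 2 * t * dot p w (mv p A v) + t\<^sup>2 * qf p A w"
      using dot_mv_sym[OF sym, of v w]
      by (simp add: qf_eq_dot dot_simps power2_eq_square algebra_simps dot_commute)
    moreover have "nsq p ?u = 1 + 2 * t * dot p w v + t\<^sup>2 * nsq p w"
      using nv by (simp add: nsq_eq_dot dot_simps power2_eq_square algebra_simps dot_commute)
    moreover have "dot p w (mv p A v) = dot p w w + m * dot p w v"
    proof -
      have "w = (\<lambda>i. mv p A v i - m * v i)" by (simp add: w_def fun_eq_iff)
      then have "dot p w w = dot p w (\<lambda>i. mv p A v i - m * v i)" by simp
      then show ?thesis by (simp add: dot_diff_right dot_scale_right)
    qed
    ultimately show ?thesis using min[of ?u]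
      by (simp add: m_def[symmetric] algebra_simps)
  qed
  then have "dot p w w = 0" by (rule quadratic_nonneg_linear_coeff)
  then have w0: "mv p A v i = m * v i" if "i < p" for i
    using that by (simp add: nsq_eq_dot[symmetric] nsq_eq_0_iff w_def)
  have Ac: "A \<in> carrier_mat p p" using sym by (simp add: sym_on_def)
  have "eigenvector A (vec p v) m"
    unfolding eigenvector_def
  proof (intro conjI)
    show "vec p v \<in> carrier_vec (dim_row A)" using Ac by auto
    have "\<not> (\<forall>i<p. v i = 0)" using nv nsq_eq_0_iff[of p v] by simp
    then show "vec p v \<noteq> 0\<^sub>v (dim_row A)" using Ac by (auto simp: vec_eq_iff)
    show "A *\<^sub>v vec p v = m \<cdot>\<^sub>v vec p v"
      using Ac w0 by (auto simp: mult_mat_vec_eq_mv)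
  qed
  then show ?thesis using min unfolding eigenvalue_def by blast
qed

lemma qf_uminus: "A \<in> carrier_mat p p \<Longrightarrow> qf p (- A) v = - qf p A v"
  by (simp add: qf_def sum_negf[symmetric])

lemma rayleigh_max:
  assumes sym: "sym_on p A" and p: "p > 0"
  shows "\<exists>k. eigenvalue A k \<and> (\<forall>v. qf p A v \<le> k * nsq p v)"
proof -
  have A: "A \<in> carrier_mat p p" using sym by (simp add: sym_on_def)
  have "sym_on p (- A)" using sym by (auto simp: sym_on_def)
  from rayleigh_min[OF this p] obtain k where k: "eigenvalue (- A) k"
    "\<And>v. k * nsq p v \<le> - qf p A v" using A by (auto simp: qf_uminus)
  have "eigenvalue A (- k)"
  proof -
    from k(1) obtain x where x: "x \<in> carrier_vec p" "x \<noteq> 0\<^sub>v p" "- A *\<^sub>v x = k \<cdot>\<^sub>v x"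
      using A by (auto simp: eigenvalue_def eigenvector_def)
    have "A *\<^sub>v x = - k \<cdot>\<^sub>v x"
    proof (rule eq_vecI)
      fix i assume i: "i < dim_vec (- k \<cdot>\<^sub>v x)"
      have "- (A *\<^sub>v x) = k \<cdot>\<^sub>v x" using x(3) A x(1) by simp
      then have "(- (A *\<^sub>v x)) $ i = (k \<cdot>\<^sub>v x) $ i" by simp
      moreover have "i < p" using x i by simp
      ultimately show "(A *\<^sub>v x) $ i = (- k \<cdot>\<^sub>v x) $ i" using A x(1) by (simp del: index_mult_mat_vec)
    qed (use A x in auto)
    then show ?thesis using x A by (auto simp: eigenvalue_def eigenvector_def)
  qed
  moreover have "qf p A v \<le> - k * nsq p v" for v using k(2)[of v] by simp
  ultimately show ?thesis by blast
qed

lemma eigenvalue_qf: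
  assumes "eigenvalue A k" "A \<in> carrier_mat p p"
  obtains v where "nsq p v > 0" "qf p A v = k * nsq p v"
proof -
  from assms obtain x where x: "x \<in> carrier_vec p" "x \<noteq> 0\<^sub>v p" "A *\<^sub>v x = k \<cdot>\<^sub>v x"
    by (auto simp: eigenvalue_def eigenvector_def)
  define v where "v i = x $ i" for i
  have xv: "x = vec p v" using x by (auto simp: v_def)
  have "vec p (mv p A v) = k \<cdot>\<^sub>v vec p v"
    using x(3) unfolding xv mult_mat_vec_eq_mv[OF assms(2)] .
  then have "mv p A v i = k * v i" if "i < p" for i
    using that by (metis index_smult_vec(1) index_vec dim_vec)
  then have "qf p A v = k * nsq p v"
    by (simp add: qf_eq_dot nsq_def dot_def sum_distrib_left power2_eq_square mult.left_commute)
  moreover have "nsq p v \<noteq> 0" using x(2) unfolding xv nsq_eq_0_iff by (auto simp: vec_eq_iff)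
  ultimately show ?thesis using that[of v] nsq_nonneg[of p v] by simp
qed

lemma finite_eigenvalues:
  fixes A :: "real mat"
  assumes "A \<in> carrier_mat p p"
  shows "finite {k. eigenvalue A k}"
proof -
  have "char_poly A \<noteq> 0" using degree_monic_char_poly[OF assms] by auto
  then have "finite {k. poly (char_poly A) k = 0}" by (rule poly_roots_finite)
  then show ?thesis using eigenvalue_root_char_poly[OF assms] by simp
qed

text \<open>An extremum over eigenvalues becomes an inequality between quadratic forms, which
  survives perturbation and is closed in the matrix. The Rayleigh minimum makes the set of
  eigenvalues nonempty; for \<open>p = 0\<close> it would be empty and its \<open>Min\<close>
  unspecified.\<close>

lemma lambda_min_ge_iff:
  assumes sym: "sym_on p A" and p: "p > 0"
  shows "m \<le> lambda_min A \<longleftrightarrow> (\<forall>v. m * nsq p v \<le> qf p A v)"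
proof
  have A: "A \<in> carrier_mat p p" using sym by (simp add: sym_on_def)
  note fin = finite_eigenvalues[OF A]
  obtain k where k: "eigenvalue A k" "\<And>v. k * nsq p v \<le> qf p A v"
    using rayleigh_min[OF sym p] by blast
  have "lambda_min A \<le> k" unfolding lambda_min_def using fin k by (intro Min_le) auto
  then show "\<forall>v. m * nsq p v \<le> qf p A v" if "m \<le> lambda_min A"
    using that k(2) nsq_nonneg[of p] by (meson mult_right_mono order_trans)
  assume *: "\<forall>v. m * nsq p v \<le> qf p A v"
  have "m \<le> l" if "eigenvalue A l" for l
    using eigenvalue_qf[OF that A] * by (metis mult_le_cancel_right_pos)
  then show "m \<le> lambda_min A"
    unfolding lambda_min_def using k fin by (subst Min_ge_iff) auto
qed

lemma lambda_max_le_iff: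
  assumes sym: "sym_on p A" and p: "p > 0"
  shows "lambda_max A \<le> m \<longleftrightarrow> (\<forall>v. qf p A v \<le> m * nsq p v)"
proof
  have A: "A \<in> carrier_mat p p" using sym by (simp add: sym_on_def)
  note fin = finite_eigenvalues[OF A]
  obtain k where k: "eigenvalue A k" "\<And>v. qf p A v \<le> k * nsq p v"
    using rayleigh_max[OF sym p] by blast
  have "k \<le> lambda_max A" unfolding lambda_max_def using fin k by (intro Max_ge) auto
  then show "\<forall>v. qf p A v \<le> m * nsq p v" if "lambda_max A \<le> m"
    using that k(2) nsq_nonneg[of p] by (meson mult_right_mono order_trans)
  assume *: "\<forall>v. qf p A v \<le> m * nsq p v"
  have "l \<le> m" if "eigenvalue A l" for l
    using eigenvalue_qf[OF that A] * by (metis mult_le_cancel_right_pos)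
  then show "lambda_max A \<le> m"
    unfolding lambda_max_def using k fin by (subst Max_le_iff) auto
qed

lemma lambda_min_le_lambda_max:
  assumes sym: "sym_on p A" and p: "p > 0"
  shows "lambda_min A \<le> lambda_max A"
proof -
  have A: "A \<in> carrier_mat p p" using sym by (simp add: sym_on_def)
  obtain k where k: "eigenvalue A k" using rayleigh_min[OF sym p] by blast
  with finite_eigenvalues[OF A] have "lambda_min A \<le> k" "k \<le> lambda_max A"
    unfolding lambda_min_def lambda_max_def by (auto intro: Min_le Max_ge)
  then show ?thesis by simp
qed

text \<open>Positive definiteness comes for free from the lower bound 1/\<tau> > 0. The criterion
  serves twice: for matrices near the true one, and for measurability, where each vector contributes
  a closed condition.\<close>

lemma U_tau_iff_qf:
  assumes sym: "sym_on p A" and p: "p > 0" and \<tau>: "\<tau> > 0"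
  shows "A \<in> U_tau p \<tau> \<longleftrightarrow> (\<forall>v. 1 / \<tau> * nsq p v \<le> qf p A v \<and> qf p A v \<le> \<tau> * nsq p v)"
proof
  assume "A \<in> U_tau p \<tau>"
  then have "1 / \<tau> \<le> lambda_min A" "lambda_max A \<le> \<tau>" by (simp_all add: U_tau_def)
  then show "\<forall>v. 1 / \<tau> * nsq p v \<le> qf p A v \<and> qf p A v \<le> \<tau> * nsq p v"
    unfolding lambda_min_ge_iff[OF sym p] lambda_max_le_iff[OF sym p] by blast
next
  assume *: "\<forall>v. 1 / \<tau> * nsq p v \<le> qf p A v \<and> qf p A v \<le> \<tau> * nsq p v"
  have "qf p A v > 0" if "\<exists>i<p. v i \<noteq> 0" for v
  proof -
    have "nsq p v > 0" using that nsq_eq_0_iff[of p v] nsq_nonneg[of p v] by fastforce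
    then have "1 / \<tau> * nsq p v > 0" using \<tau> by simp
    then show ?thesis using * by (meson less_le_trans)
  qed
  then have "pos_def_mat p A" using sym by (simp add: pos_def_mat_iff_qf sym_on_def)
  moreover have "1 / \<tau> \<le> lambda_min A"
    using * by (subst lambda_min_ge_iff[OF sym p]) blast
  moreover have "lambda_max A \<le> \<tau>"
    using * by (subst lambda_max_le_iff[OF sym p]) blast
  ultimately show "A \<in> U_tau p \<tau>"
    using lambda_min_le_lambda_max[OF sym p] by (simp add: U_tau_def)
qed

section \<open>The chi-square divergence of two Gaussian densities\<close>

text \<open>The inverse exists because the Gaussian integral lemma makes the determinant positive.
  Its transpose is a left inverse of \<open>A\<close>, hence the inverse itself. With w = B u one
  has u.Bu = w.Aw, so positivity is inherited.\<close>

lemma pos_def_mat_inverse: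
  assumes pd: "pos_def_mat p A"
  obtains B where "mat_inverse A = Some B" "pos_def_mat p B" "A * B = 1\<^sub>m p" "B * A = 1\<^sub>m p"
proof -
  have A: "A \<in> carrier_mat p p" and AT: "A\<^sup>T = A" using pd by (simp_all add: pos_def_mat_def)
  have "det A \<noteq> 0" using gauss_integral[OF pd] by simp
  then have "A \<in> Units (ring_mat TYPE(real) p ())"
    by (rule det_non_zero_imp_unit[OF A])
  then obtain B where B: "mat_inverse A = Some B"
    using mat_inverse(1)[OF A, where b = "()"] by blast
  then have AB: "A * B = 1\<^sub>m p" and BA: "B * A = 1\<^sub>m p" and Bc: "B \<in> carrier_mat p p"
    using mat_inverse(2)[OF A] by auto
  have "B\<^sup>T * A = 1\<^sub>m p"
    using transpose_mult[OF A Bc] by (simp add: AB AT)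
  then have BT: "B\<^sup>T = B"
    using assoc_mult_mat[of "B\<^sup>T" p p A p B p] A Bc AB by simp
  have "qf p B u > 0" if u: "\<exists>i<p. u i \<noteq> 0" for u
  proof -
    define w where "w = mv p B u"
    have uw: "mv p A w i = u i" if "i < p" for i
      using mv_mult[OF A Bc that, of u] that by (simp add: AB mv_one w_def)
    have "qf p B u = dot p (mv p A w) w"
      unfolding qf_eq_dot w_def[symmetric] by (intro dot_cong) (auto simp: uw)
    also have "\<dots> = qf p A w" by (simp add: qf_eq_dot dot_commute)
    also have "qf p A w > 0"
    proof -
      have "\<exists>i<p. w i \<noteq> 0"
      proof (rule ccontr)
        assume "\<not> ?thesis"
        then have "mv p A w i = 0" for i by (simp add: mv_def)
        with u uw show False by force
      qed
      then show ?thesis using pd pos_def_mat_iff_qf by blast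
    qed
    finally show ?thesis .
  qed
  moreover have "\<forall>i<p. \<forall>j<p. B $$ (i, j) = B $$ (j, i)"
    using BT Bc by (metis carrier_matD index_transpose_mat(1))
  ultimately have "pos_def_mat p B" using Bc by (simp add: pos_def_mat_iff_qf)
  then show ?thesis using that B AB BA by blast
qed

text \<open>With w = B u, so that u.w = w.Aw \<ge> a |w|^2, the bound is what 0 \<le> |a w - u|^2
  says after expansion.\<close>

lemma qf_inverse_le:
  assumes pdA: "pos_def_mat p A" and B: "B \<in> carrier_mat p p" and AB: "A * B = 1\<^sub>m p"
    and a: "a > 0" and lower: "\<And>v. a * nsq p v \<le> qf p A v"
  shows "qf p B u \<le> nsq p u / a"
proof -
  have A: "A \<in> carrier_mat p p" using pdA by (rule pos_def_mat_carrier)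
  define w where "w = mv p B u"
  have uw: "mv p A w i = u i" if "i < p" for i
    using mv_mult[OF A B that, of u] that by (simp add: AB mv_one w_def)
  have q: "qf p B u = dot p u w" by (simp add: qf_eq_dot w_def)
  have "dot p u w = dot p (mv p A w) w" by (intro dot_cong) (auto simp: uw)
  then have q': "dot p u w = qf p A w" by (simp add: qf_eq_dot dot_commute)
  have "0 \<le> nsq p (\<lambda>i. a * w i - u i)" by (rule nsq_nonneg)
  also have "\<dots> = a * (a * nsq p w) - 2 * a * dot p u w + nsq p u"
    by (simp add: nsq_eq_dot dot_simps dot_commute algebra_simps)
  also have "\<dots> \<le> a * qf p A w - 2 * a * dot p u w + nsq p u"
    using a lower[of w] by simp
  finally have "a * dot p u w \<le> nsq p u" using q' by simp
  then show ?thesis using a q by (simp add: field_simps)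
qed

lemma gauss_dens_eq_qf:
  assumes "mat_inverse S = Some B" "B \<in> carrier_mat p p"
  shows "gauss_dens p S x = (2 * pi) powr (- real p / 2) * det S powr (-1/2) * exp (- 1/2 * qf p B x)"
  using assms by (simp add: gauss_dens_def scalar_prod_mult_mat_vec_eq_qf)

lemma gauss_dens_pos:
  assumes "pos_def_mat p S"
  shows "gauss_dens p S x > 0"
  using gauss_integral[OF assms] by (simp add: gauss_dens_def)

lemma measurable_gauss_dens:
  assumes "pos_def_mat p S"
  shows "gauss_dens p S \<in> borel_measurable (lborel_p p)"
proof -
  obtain B where B: "mat_inverse S = Some B" "pos_def_mat p B"
    using pos_def_mat_inverse[OF assms] by metis
  note [measurable] = measurable_qf_lborel[of p B]
  show ?thesis
    unfolding gauss_dens_eq_qf[OF B(1) pos_def_mat_carrier[OF B(2)]] by measurable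
qed

lemma powr_half_mult_self: "x > 0 \<Longrightarrow> (x::real) powr (-1/2) * x powr (-1/2) = 1 / x"
  by (simp add: powr_add[symmetric] powr_minus_divide)

lemma nn_integral_gauss_dens:
  assumes "pos_def_mat p S"
  shows "(\<integral>\<^sup>+x. ennreal (gauss_dens p S x) \<partial>lborel_p p) = 1"
proof -
  obtain B where B: "mat_inverse S = Some B" "pos_def_mat p B" "S * B = 1\<^sub>m p"
    using pos_def_mat_inverse[OF assms] by metis
  have Sc: "S \<in> carrier_mat p p" and Bc: "B \<in> carrier_mat p p"
    using assms B pos_def_mat_carrier by auto
  have dS: "det S > 0" and dB: "det B > 0" using gauss_integral assms B(2) by auto
  have "det S * det B = 1" using det_mult[OF Sc Bc] B(3) by simp
  then have d1: "det S powr (-1/2) * det B powr (-1/2) = 1"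
    using powr_mult[of "det S" "det B" "-1/2"] by simp
  have d2: "(2 * pi) powr (- real p / 2) * (2 * pi) powr (real p / 2) = 1"
    by (simp add: powr_add[symmetric])
  note [measurable] = measurable_qf_lborel[of p B]
  let ?C = "(2 * pi) powr (- real p / 2) * det S powr (-1/2)"
  have "(\<integral>\<^sup>+x. ennreal (gauss_dens p S x) \<partial>lborel_p p) =
      ennreal ?C * (\<integral>\<^sup>+x. ennreal (exp (- 1/2 * qf p B x)) \<partial>lborel_p p)"
    unfolding gauss_dens_eq_qf[OF B(1) Bc]
    by (subst nn_integral_cmult[symmetric]) (auto simp: ennreal_mult intro!: nn_integral_cong)
  also have "\<dots> = ennreal (?C * ((2 * pi) powr (real p / 2) * det B powr (-1/2)))"
    using gauss_integral[OF B(2)] by (simp add: ennreal_mult)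
  also have "?C * ((2 * pi) powr (real p / 2) * det B powr (-1/2)) =
      ((2 * pi) powr (- real p / 2) * (2 * pi) powr (real p / 2)) *
      (det S powr (-1/2) * det B powr (-1/2))"
    by (simp only: mult_ac)
  finally show ?thesis unfolding d1 d2 by simp
qed

section \<open>The second moment of the likelihood ratio of two centred Gaussians\<close>

lemma transpose_conjugate:
  fixes A B :: "real mat"
  assumes A: "A \<in> carrier_mat p p" and B: "B \<in> carrier_mat p p" and T: "A\<^sup>T = A" "B\<^sup>T = B"
  shows "(A * (B * A))\<^sup>T = A * (B * A)"
proof -
  have "(A * (B * A))\<^sup>T = (B * A)\<^sup>T * A\<^sup>T"
    using A B by (intro transpose_mult[of _ p p _ p]) auto
  also have "(B * A)\<^sup>T = A\<^sup>T * B\<^sup>T"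
    using A B by (intro transpose_mult[of _ p p _ p]) auto
  also have "A\<^sup>T * B\<^sup>T * A\<^sup>T = A * (B * A)"
    unfolding T using A B by (intro assoc_mult_mat[of _ p p _ p _ p]) auto
  finally show ?thesis .
qed

lemma qf_smult: "A \<in> carrier_mat p p \<Longrightarrow> qf p (c \<cdot>\<^sub>m A) v = c * qf p A v"
  by (auto simp: qf_def sum_distrib_left mult.assoc intro!: sum.cong)

lemma pos_def_mat_smult:
  assumes "pos_def_mat p A" "c > 0"
  shows "pos_def_mat p (c \<cdot>\<^sub>m A)"
proof -
  have A: "A \<in> carrier_mat p p" using assms by (simp add: pos_def_mat_def)
  show ?thesis using assms A unfolding pos_def_mat_iff_qf by (auto simp: qf_smult)
qed

lemma mv_minus:
  assumes "A \<in> carrier_mat p p" "N \<in> carrier_mat p p" "i < p"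
  shows "mv p (A - N) v i = mv p A v i - mv p N v i"
  unfolding mv_def sum_subtractf[symmetric]
  using assms by (auto simp: algebra_simps intro!: sum.cong)

lemma mv_smult_minus:
  assumes "A \<in> carrier_mat p p" "N \<in> carrier_mat p p" "i < p"
  shows "mv p (c \<cdot>\<^sub>m A - N) v i = c * mv p A v i - mv p N v i"
  unfolding mv_def sum_distrib_left sum_subtractf[symmetric]
  using assms by (auto simp: algebra_simps intro!: sum.cong)

text \<open>The hypothesis \<open>close\<close> is the matrix inequality E \<Omega> E \<le> (1 -
  \<kappa>) S for E = S - S0. It does double duty: it makes the exponent of f0^2/f negative
  definite, so that the integral is finite, and it bounds the value. Matrix identities are checked
  on vectors through \<open>mv\<close>, where inverses simply cancel.\<close>

lemma chi_square_gauss: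
  assumes pd0: "pos_def_mat p S0" and pd: "pos_def_mat p S" and \<kappa>: "\<kappa> > 0"
    and inv: "mat_inverse S = Some \<Omega>"
    and close: "\<And>v. qf p \<Omega> (mv p (S - S0) v) \<le> (1 - \<kappa>) * qf p S v"
  shows "(\<integral>\<^sup>+x. ennreal ((gauss_dens p S0 x)\<^sup>2 / gauss_dens p S x) \<partial>lborel_p p)
    \<le> ennreal ((\<kappa> ^ p) powr (-1/2))"
proof -
  obtain \<Omega>0 where O0: "mat_inverse S0 = Some \<Omega>0" "pos_def_mat p \<Omega>0" "S0 * \<Omega>0 = 1\<^sub>m p" "\<Omega>0 * S0 = 1\<^sub>m p"
    using pos_def_mat_inverse[OF pd0] by metis
  have O: "pos_def_mat p \<Omega>" "S * \<Omega> = 1\<^sub>m p" "\<Omega> * S = 1\<^sub>m p"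
    using pos_def_mat_inverse[OF pd] inv by (metis option.inject)+
  note [simp] = pd0[THEN pos_def_mat_carrier] pd[THEN pos_def_mat_carrier]
    O0(2)[THEN pos_def_mat_carrier] O(1)[THEN pos_def_mat_carrier]
  note sym = pd0[THEN pos_def_mat_sym_on] pd[THEN pos_def_mat_sym_on]
    O0(2)[THEN pos_def_mat_sym_on] O(1)[THEN pos_def_mat_sym_on]
  have cancel: "mv p S (mv p \<Omega> v) i = v i" "mv p \<Omega> (mv p S v) i = v i"
    "mv p S0 (mv p \<Omega>0 v) i = v i" "mv p \<Omega>0 (mv p S0 v) i = v i" if "i < p" for v i
    using that by (simp_all flip: mv_mult add: O O0 mv_one)
  \<comment> \<open>This is S - E \<Omega> E multiplied out; in this form conjugation by
    \<open>\<Omega>0\<close> visibly gives 2 \<Omega>0 - \<Omega>.\<close>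
  define M where "M = 2 \<cdot>\<^sub>m S0 - S0 * (\<Omega> * S0)"
  have Mc: "M \<in> carrier_mat p p" unfolding M_def
    by (intro minus_carrier_mat mult_carrier_mat[of _ p p]) auto
  have mvM: "mv p M v i = 2 * mv p S0 v i - mv p S0 (mv p \<Omega> (mv p S0 v)) i" if "i < p" for v i
  proof -
    have "mv p M v i = 2 * mv p S0 v i - mv p (S0 * (\<Omega> * S0)) v i"
      unfolding M_def using that by (intro mv_smult_minus mult_carrier_mat[of _ p p _ p]) simp_all
    also have "mv p (S0 * (\<Omega> * S0)) v i = mv p S0 (mv p (\<Omega> * S0) v) i"
      using that by (intro mv_mult mult_carrier_mat[of _ p p _ p]) simp_all
    also have "mv p S0 (mv p (\<Omega> * S0) v) = mv p S0 (mv p \<Omega> (mv p S0 v))"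
      by (intro mv_cong mv_mult) auto
    finally show ?thesis .
  qed
  \<comment> \<open>The matrix in the exponent of f0^2/f. As a conjugate of \<open>M\<close> it
    inherits positivity, and its determinant factors.\<close>
  define P where "P = \<Omega>0 * (M * \<Omega>0)"
  have Pc: "P \<in> carrier_mat p p" unfolding P_def
    using Mc by (intro mult_carrier_mat[of _ p p]) auto
  have mvP: "mv p P v i = mv p \<Omega>0 (mv p M (mv p \<Omega>0 v)) i" if "i < p" for v i
  proof -
    have "mv p P v i = mv p \<Omega>0 (mv p (M * \<Omega>0) v) i"
      unfolding P_def using that Mc by (intro mv_mult) auto
    also have "mv p \<Omega>0 (mv p (M * \<Omega>0) v) = mv p \<Omega>0 (mv p M (mv p \<Omega>0 v))"
      using Mc by (intro mv_cong mv_mult) auto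
    finally show ?thesis .
  qed
  have qfP: "qf p P v = 2 * qf p \<Omega>0 v - qf p \<Omega> v" for v
  proof -
    have 1: "mv p M (mv p \<Omega>0 v) i = 2 * v i - mv p S0 (mv p \<Omega> v) i" if "i < p" for i
    proof -
      have "mv p \<Omega> (mv p S0 (mv p \<Omega>0 v)) = mv p \<Omega> v" by (intro mv_cong cancel)
      then show ?thesis using that by (simp add: mvM cancel)
    qed
    have "mv p P v i = 2 * mv p \<Omega>0 v i - mv p \<Omega> v i" if "i < p" for i
    proof -
      have "mv p P v i = mv p \<Omega>0 (\<lambda>i. 2 * v i - mv p S0 (mv p \<Omega> v) i) i"
        unfolding mvP[OF that] by (rule fun_cong[OF mv_cong]) (rule 1)
      then show ?thesis using that by (simp add: mv_diff mv_scale cancel)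
    qed
    then have "qf p P v = dot p v (\<lambda>i. 2 * mv p \<Omega>0 v i - mv p \<Omega> v i)"
      unfolding qf_eq_dot by (intro dot_cong) auto
    then show ?thesis by (simp add: qf_eq_dot dot_simps)
  qed
  \<comment> \<open>After substituting S0 v = S v - E v in both terms of \<open>M\<close>, the terms
    linear in E cancel.\<close>
  have qfM: "\<kappa> * qf p S v \<le> qf p M v" for v
  proof -
    let ?e = "mv p (S - S0) v"
    have S0v: "mv p S0 v i = mv p S v i - ?e i" if "i < p" for i
    proof -
      have "?e i = mv p S v i - mv p S0 v i"
        using that by (intro mv_minus) simp_all
      then show ?thesis by simp
    qed
    have "qf p M v = dot p v (\<lambda>i. 2 * mv p S0 v i - mv p S0 (mv p \<Omega> (mv p S0 v)) i)"
      unfolding qf_eq_dot by (intro dot_cong) (auto simp: mvM)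
    also have "\<dots> = 2 * dot p v (mv p S0 v) - dot p (mv p S0 v) (mv p \<Omega> (mv p S0 v))"
      by (simp add: dot_simps dot_mv_sym[OF sym(1)])
    also have "dot p v (mv p S0 v) = dot p v (\<lambda>i. mv p S v i - ?e i)"
      by (intro dot_cong) (auto simp: S0v)
    also have "\<dots> = qf p S v - dot p v ?e" by (simp add: dot_simps qf_eq_dot)
    also have "dot p (mv p S0 v) (mv p \<Omega> (mv p S0 v)) =
        dot p (\<lambda>i. mv p S v i - ?e i) (mv p \<Omega> (\<lambda>i. mv p S v i - ?e i))"
    proof (intro dot_cong)
      show "mv p \<Omega> (mv p S0 v) i = mv p \<Omega> (\<lambda>i. mv p S v i - ?e i) i" for i
        by (rule fun_cong[OF mv_cong]) (rule S0v)
    qed (rule S0v)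
    also have "\<dots> = dot p (\<lambda>i. mv p S v i - ?e i) (\<lambda>i. v i - mv p \<Omega> ?e i)"
      by (intro dot_cong) (auto simp: mv_diff cancel)
    also have "\<dots> = qf p S v - dot p v ?e - dot p (mv p S v) (mv p \<Omega> ?e) + qf p \<Omega> ?e"
      by (simp add: dot_simps qf_eq_dot dot_commute algebra_simps)
    also have "dot p (mv p S v) (mv p \<Omega> ?e) = dot p v (mv p S (mv p \<Omega> ?e))"
      by (rule dot_mv_sym[OF sym(2), symmetric])
    also have "\<dots> = dot p v ?e" by (intro dot_cong) (auto simp: cancel)
    finally have "qf p M v = qf p S v - qf p \<Omega> ?e" by simp
    then show ?thesis using close[of v] by (simp add: algebra_simps)
  qed
  have symM: "M $$ (i, j) = M $$ (j, i)" if "i < p" "j < p" for i j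
  proof -
    have "M\<^sup>T = M"
    proof -
      have T: "S0\<^sup>T = S0" "\<Omega>\<^sup>T = \<Omega>" using pd0 O(1) by (simp_all add: pos_def_mat_def)
      have "(S0 * (\<Omega> * S0))\<^sup>T = S0 * (\<Omega> * S0)"
        using T by (intro transpose_conjugate[of _ p]) simp_all
      moreover have "(2 \<cdot>\<^sub>m S0)\<^sup>T = 2 \<cdot>\<^sub>m S0\<^sup>T" by (rule eq_matI) auto
      moreover have "M\<^sup>T = (2 \<cdot>\<^sub>m S0)\<^sup>T - (S0 * (\<Omega> * S0))\<^sup>T"
        unfolding M_def
        by (subst transpose_minus[of _ p p]) (simp_all add: mult_carrier_mat[of _ p p _ p])
      ultimately show ?thesis by (simp add: M_def T)
    qed
    then show ?thesis using that Mc by (metis carrier_matD index_transpose_mat(1))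
  qed
  have pdM: "pos_def_mat p M"
    unfolding pos_def_mat_iff_qf
  proof (intro conjI allI impI)
    show "0 < qf p M v" if "\<exists>i<p. v i \<noteq> 0" for v
    proof -
      have "0 < \<kappa> * qf p S v" using \<kappa> that pd by (simp add: pos_def_mat_iff_qf)
      then show ?thesis using qfM[of v] by simp
    qed
  qed (use Mc symM in auto)
  have pdP: "pos_def_mat p P"
    unfolding pos_def_mat_def
  proof (intro conjI)
    show "P\<^sup>T = P"
    proof -
      have T: "\<Omega>0\<^sup>T = \<Omega>0" "M\<^sup>T = M" using O0(2) pdM by (simp_all add: pos_def_mat_def)
      then show ?thesis using Mc unfolding P_def by (intro transpose_conjugate[of _ p]) simp_all
    qed
    have "qf p P v > 0" if "\<exists>i<p. v i \<noteq> 0" for v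
    proof -
      have "\<exists>i<p. mv p \<Omega>0 v i \<noteq> 0"
      proof (rule ccontr)
        assume "\<not> ?thesis"
        then have "mv p S0 (mv p \<Omega>0 v) i = 0" for i by (simp add: mv_def[of p S0])
        then show False using cancel(3)[of _ v] that by auto
      qed
      then have "qf p M (mv p \<Omega>0 v) > 0" using pdM pos_def_mat_iff_qf by blast
      also have "qf p M (mv p \<Omega>0 v) = dot p v (mv p \<Omega>0 (mv p M (mv p \<Omega>0 v)))"
        by (simp add: qf_eq_dot dot_mv_sym[OF sym(3)])
      also have "\<dots> = qf p P v" unfolding qf_eq_dot by (intro dot_cong) (auto simp: mvP)
      finally show ?thesis .
    qed
    then show "\<forall>v\<in>carrier_vec p. v \<noteq> 0\<^sub>v p \<longrightarrow> 0 < v \<bullet> (P *\<^sub>v v)"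
    proof (intro ballI impI)
      fix v :: "real vec" assume v: "v \<in> carrier_vec p" "v \<noteq> 0\<^sub>v p"
      assume *: "\<And>v. \<exists>i<p. v i \<noteq> 0 \<Longrightarrow> 0 < qf p P v"
      have "\<exists>i<p. v $ i \<noteq> 0" using v by (auto simp: vec_eq_iff)
      then have "qf p P (\<lambda>i. v $ i) > 0" by (rule *)
      moreover have "vec p (\<lambda>i. v $ i) = v" using v by auto
      ultimately show "0 < v \<bullet> (P *\<^sub>v v)"
        using scalar_prod_mult_mat_vec_eq_qf[OF Pc, of "\<lambda>i. v $ i"] by simp
    qed
  qed (rule Pc)
  have d: "det S > 0" "det S0 > 0" "det M > 0" "det P > 0" "det \<Omega>0 > 0"
    using gauss_integral pd pd0 pdM pdP O0(2) by auto
  have "\<kappa> ^ p * det S \<le> det M"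
  proof -
    have pdk: "pos_def_mat p (\<kappa> \<cdot>\<^sub>m S)" using pd \<kappa> by (rule pos_def_mat_smult)
    have dk: "det (\<kappa> \<cdot>\<^sub>m S) = \<kappa> ^ p * det S"
      using carrier_matD(2)[OF pos_def_mat_carrier[OF pd]] by simp
    \<comment> \<open>Monotonicity of the determinant is read off from Gaussian integrals: the
      larger form has the smaller integral, and the integral decreases in the determinant.\<close>
    have "(\<integral>\<^sup>+x. ennreal (exp (- 1/2 * qf p M x)) \<partial>lborel_p p) \<le>
        (\<integral>\<^sup>+x. ennreal (exp (- 1/2 * qf p (\<kappa> \<cdot>\<^sub>m S) x)) \<partial>lborel_p p)"
      using qfM by (intro nn_integral_mono ennreal_leI) (simp add: qf_smult)
    then have "(2 * pi) powr (real p / 2) * det M powr (-1/2) \<le>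
      (2 * pi) powr (real p / 2) * (\<kappa> ^ p * det S) powr (-1/2)"
      using gauss_integral[OF pdM] gauss_integral[OF pdk] unfolding dk by (simp add: ennreal_le_iff)
    then have le: "det M powr (-1/2) \<le> (\<kappa> ^ p * det S) powr (-1/2)"
      by simp
    show ?thesis
    proof (rule ccontr)
      assume "\<not> ?thesis"
      then have "(\<kappa> ^ p * det S) powr (-1/2) < det M powr (-1/2)"
        using d by (intro powr_less_mono2_neg) auto
      with le show False by simp
    qed
  qed
  let ?c = "(2 * pi) powr (real p / 2)"
  have c: "?c > 0" by simp
  have c': "(2 * pi) powr (- real p / 2) = 1 / ?c" by (simp add: powr_minus_divide)
  note [measurable] = measurable_qf_lborel[of p P]
  have ratio: "(gauss_dens p S0 x)\<^sup>2 / gauss_dens p S x =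
      1 / ?c * (1 / det S0) / det S powr (-1/2) * exp (- 1/2 * qf p P x)" for x
  proof -
    have "(det S0 powr (-1/2))\<^sup>2 = 1 / det S0"
      using d powr_half_mult_self by (simp add: power2_eq_square)
    moreover have "exp (- 1/2 * qf p P x) = (exp (- 1/2 * qf p \<Omega>0 x))\<^sup>2 / exp (- 1/2 * qf p \<Omega> x)"
      by (simp add: qfP power2_eq_square exp_add[symmetric] exp_diff[symmetric] diff_divide_distrib)
    ultimately show ?thesis
      using c unfolding gauss_dens_eq_qf[OF inv pos_def_mat_carrier[OF O(1)]]
        gauss_dens_eq_qf[OF O0(1) pos_def_mat_carrier[OF O0(2)]] c' power_mult_distrib
      by (simp add: power2_eq_square)
  qed
  have "(\<integral>\<^sup>+x. ennreal ((gauss_dens p S0 x)\<^sup>2 / gauss_dens p S x) \<partial>lborel_p p) =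
     ennreal (1 / ?c * (1 / det S0) / det S powr (-1/2)) * (\<integral>\<^sup>+x. ennreal (exp (- 1/2 * qf p P x)) \<partial>lborel_p p)"
    unfolding ratio using d
    by (subst nn_integral_cmult[symmetric]) (auto simp: ennreal_mult[symmetric] intro!: nn_integral_cong)
  also have "\<dots> = ennreal (1 / ?c * (1 / det S0) / det S powr (-1/2) * (?c * det P powr (-1/2)))"
    unfolding conjunct2[OF gauss_integral[OF pdP]] using d
    by (intro ennreal_mult[symmetric]) auto
  also have "1 / ?c * (1 / det S0) / det S powr (-1/2) * (?c * det P powr (-1/2)) =
     det P powr (-1/2) / det S0 / det S powr (-1/2)"
    using c by simp
  also have "det P = det \<Omega>0 * det \<Omega>0 * det M"
    unfolding P_def using Mc by (simp add: det_mult[of _ p])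
  also have "\<dots> powr (-1/2) = det M powr (-1/2) * det S0"
  proof -
    have "det S0 * det \<Omega>0 = 1" using det_mult[of S0 p \<Omega>0] O0(3) by simp
    then have "det \<Omega>0 = 1 / det S0" using d by (simp add: field_simps)
    moreover have "(det \<Omega>0 * det \<Omega>0 * det M) powr (-1/2) =
        det \<Omega>0 powr (-1/2) * det \<Omega>0 powr (-1/2) * det M powr (-1/2)"
      by (simp only: powr_mult)
    ultimately show ?thesis using powr_half_mult_self[of "det \<Omega>0"] d by simp
  qed
  also have "det M powr (-1/2) * det S0 / det S0 / det S powr (-1/2) = det M powr (-1/2) / det S powr (-1/2)"
    using d by simp
  also have "\<dots> \<le> (\<kappa> ^ p * det S) powr (-1/2) / det S powr (-1/2)"
    using \<open>\<kappa> ^ p * det S \<le> det M\<close> d \<kappa>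
    by (intro divide_right_mono powr_mono2') auto
  also have "\<dots> = (\<kappa> ^ p) powr (-1/2)"
    unfolding powr_mult using d by simp
  finally show ?thesis by (simp add: ennreal_leI)
qed

section \<open>Kullback-Leibler neighbourhoods\<close>

text \<open>Meant for x = ln (f/g), where the right side becomes 2 (f/g + g/f - 2). The factor 2 is
  the price of estimating exp(-y) by its tangent while exp(y) is expanded to second order.\<close>

lemma exp_plus_exp_minus_ge:
  fixes x :: real
  shows "x\<^sup>2 \<le> 2 * (exp x + exp (- x) - 2)"
proof -
  have *: "y\<^sup>2 \<le> 2 * (exp y + exp (- y) - 2)" if "y \<ge> 0" for y :: real
    using exp_lower_Taylor_quadratic[OF that] exp_ge_add_one_self[of "- y"]
    by (simp add: power2_eq_square field_simps)
  show ?thesis using *[of x] *[of "- x"] by (cases "x \<ge> 0") (auto simp: add.commute)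
qed

lemma ln_ratio_le_chi_square:
  fixes f g :: "'a \<Rightarrow> real"
  assumes [measurable]: "f \<in> borel_measurable M" "g \<in> borel_measurable M"
    and pos: "\<And>x. f x > 0" "\<And>x. g x > 0"
    and f1: "(\<integral>\<^sup>+x. ennreal (f x) \<partial>M) = 1" and g1: "(\<integral>\<^sup>+x. ennreal (g x) \<partial>M) = 1"
    and chi: "(\<integral>\<^sup>+x. ennreal ((f x)\<^sup>2 / g x) \<partial>M) \<le> ennreal (1 + \<eta>)" and \<eta>: "\<eta> \<ge> 0"
  shows "(\<integral>x. f x * ln (f x / g x) \<partial>M) \<le> \<eta>"
    and "(\<integral>x. f x * (ln (f x / g x))\<^sup>2 \<partial>M) \<le> 2 * \<eta>"
proof -
  have intf: "integrable M f" and intg: "integrable M g"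
    using f1 g1 pos by (auto intro!: integrableI_nonneg simp: less_imp_le)
  have intc: "integrable M (\<lambda>x. (f x)\<^sup>2 / g x)"
    using chi pos by (intro integrableI_nonneg) (auto simp: less_imp_le less_top[symmetric] top_unique)
  have If: "(\<integral>x. f x \<partial>M) = 1" and Ig: "(\<integral>x. g x \<partial>M) = 1"
    using f1 g1 pos by (auto simp: integral_eq_nn_integral less_imp_le)
  have Ic: "(\<integral>x. (f x)\<^sup>2 / g x \<partial>M) \<le> 1 + \<eta>"
  proof -
    have "ennreal (\<integral>x. (f x)\<^sup>2 / g x \<partial>M) = (\<integral>\<^sup>+x. ennreal ((f x)\<^sup>2 / g x) \<partial>M)"
      using pos by (intro nn_integral_eq_integral[symmetric] intc) (auto simp: less_imp_le)
    with chi have "ennreal (\<integral>x. (f x)\<^sup>2 / g x \<partial>M) \<le> ennreal (1 + \<eta>)" by (simp only:)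
    then show ?thesis using \<eta> by (subst (asm) ennreal_le_iff) auto
  qed
  have sq: "f x * (f x / g x) = (f x)\<^sup>2 / g x" "f x * (g x / f x) = g x" for x
    using pos[of x] by (auto simp: power2_eq_square)
  show "(\<integral>x. f x * ln (f x / g x) \<partial>M) \<le> \<eta>"
  \<comment> \<open>The Bochner integral of a non-integrable function is 0, which lies below \<eta>
    anyway, so integrability of the integrand need not be settled.\<close>
  proof (cases "integrable M (\<lambda>x. f x * ln (f x / g x))")
    case True
    have "(\<integral>x. f x * ln (f x / g x) \<partial>M) \<le> (\<integral>x. (f x)\<^sup>2 / g x - f x \<partial>M)"
    proof (intro integral_mono True Bochner_Integration.integrable_diff intc intf)
      fix x
      have "f x * ln (f x / g x) \<le> f x * (f x / g x - 1)"
        using pos[of x] by (intro mult_left_mono ln_le_minus_one) auto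
      then show "f x * ln (f x / g x) \<le> (f x)\<^sup>2 / g x - f x"
        unfolding right_diff_distrib sq by simp
    qed
    also have "\<dots> = (\<integral>x. (f x)\<^sup>2 / g x \<partial>M) - (\<integral>x. f x \<partial>M)"
      by (intro Bochner_Integration.integral_diff intc intf)
    finally show ?thesis using If Ic by simp
  qed (simp add: not_integrable_integral_eq \<eta>)
  \<comment> \<open>The total masses of \<open>g\<close> and \<open>f\<close> are 1, so the majorant
    integrates to at most 2 ((1 + \<eta>) + 1 - 2).\<close>
  have "(\<integral>x. f x * (ln (f x / g x))\<^sup>2 \<partial>M) \<le> (\<integral>x. 2 * ((f x)\<^sup>2 / g x + g x - 2 * f x) \<partial>M)"
  proof (rule integral_mono')
    show "integrable M (\<lambda>x. 2 * ((f x)\<^sup>2 / g x + g x - 2 * f x))"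
      using intf intg intc
      by (intro integrable_mult_right Bochner_Integration.integrable_diff
          Bochner_Integration.integrable_add)
    fix x
    show *: "f x * (ln (f x / g x))\<^sup>2 \<le> 2 * ((f x)\<^sup>2 / g x + g x - 2 * f x)"
    proof -
      let ?L = "ln (f x / g x)"
      have e: "exp ?L = f x / g x" "exp (- ?L) = g x / f x"
        using pos[of x] by (simp_all add: exp_minus)
      have "f x * ?L\<^sup>2 \<le> f x * (2 * (exp ?L + exp (- ?L) - 2))"
        using pos[of x] by (intro mult_left_mono exp_plus_exp_minus_ge) auto
      also have "\<dots> = 2 * (f x * (f x / g x) + f x * (g x / f x) - 2 * f x)"
        unfolding e by (simp add: algebra_simps)
      finally show ?thesis unfolding sq .
    qed
    have "0 \<le> f x * (ln (f x / g x))\<^sup>2" using pos[of x] by (simp add: less_imp_le)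
    with * show "0 \<le> 2 * ((f x)\<^sup>2 / g x + g x - 2 * f x)" by (rule order_trans[rotated])
  qed
  also have "\<dots> = 2 * (\<integral>x. (f x)\<^sup>2 / g x + g x - 2 * f x \<partial>M)"
    by (rule integral_mult_right_zero)
  also have "\<dots> = 2 * ((\<integral>x. (f x)\<^sup>2 / g x \<partial>M) + (\<integral>x. g x \<partial>M) - 2 * (\<integral>x. f x \<partial>M))"
    using intf intg intc by simp
  finally show "(\<integral>x. f x * (ln (f x / g x))\<^sup>2 \<partial>M) \<le> 2 * \<eta>" using If Ig Ic by simp
qed

lemma B_eps_if_close:
  assumes pd0: "pos_def_mat p S0" and pd: "pos_def_mat p S" and \<kappa>: "\<kappa> > 0"
    and inv: "mat_inverse S = Some \<Omega>"
    and close: "\<And>v. qf p \<Omega> (mv p (S - S0) v) \<le> (1 - \<kappa>) * qf p S v"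
    and \<eta>: "\<eta> \<ge> 0" "(\<kappa> ^ p) powr (-1/2) \<le> 1 + \<eta>" "2 * \<eta> < \<epsilon>\<^sup>2"
  shows "S \<in> B_eps p S0 \<epsilon>"
proof -
  note chi_square_gauss[OF pd0 pd \<kappa> inv close]
  also have "ennreal ((\<kappa> ^ p) powr (-1/2)) \<le> ennreal (1 + \<eta>)" using \<eta> by (intro ennreal_leI)
  finally have chi: "(\<integral>\<^sup>+x. ennreal ((gauss_dens p S0 x)\<^sup>2 / gauss_dens p S x) \<partial>lborel_p p)
      \<le> ennreal (1 + \<eta>)" .
  note * = ln_ratio_le_chi_square[OF measurable_gauss_dens[OF pd0] measurable_gauss_dens[OF pd]
    gauss_dens_pos[OF pd0] gauss_dens_pos[OF pd] nn_integral_gauss_dens[OF pd0]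
    nn_integral_gauss_dens[OF pd] chi \<eta>(1)]
  show ?thesis using * \<eta> pd by (simp add: B_eps_def KL_gauss_def V_gauss_def)
qed

section \<open>Entrywise perturbations of the true covariance matrix\<close>

definition near :: "nat \<Rightarrow> real mat \<Rightarrow> real mat \<Rightarrow> real \<Rightarrow> real \<Rightarrow> bool" where
  "near p S0 S rd ro \<longleftrightarrow> (\<forall>i<p. \<forall>j<p. \<bar>S $$ (i, j) - S0 $$ (i, j)\<bar> \<le> (if i = j then rd else ro))"

lemma sum_squared_le_card_nsq: "(\<Sum>j<p. \<bar>v j\<bar>)\<^sup>2 \<le> real p * nsq p v"
proof -
  have "(\<Sum>j<p. \<bar>v j\<bar> * 1)\<^sup>2 \<le> (\<Sum>j<p. \<bar>v j\<bar>\<^sup>2) * (\<Sum>j<p. 1\<^sup>2)"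
    by (rule Cauchy_Schwarz_ineq_sum)
  then show ?thesis by (simp add: nsq_def mult.commute)
qed

text \<open>An operator norm bound from entrywise bounds. In each row (x + y)^2 \<le> 2 x^2 + 2 y^2
  separates the diagonal term from the l1 norm of \<open>v\<close>. Cauchy-Schwarz turns that norm
  into one factor p and the sum over rows gives another; therefore \<open>ro\<close> has to be
  smaller than \<open>rd\<close> by a factor p for balance.\<close>

lemma nsq_mv_diff_le:
  assumes S: "S \<in> carrier_mat p p" and S0: "S0 \<in> carrier_mat p p"
    and near: "near p S0 S rd ro" and r: "rd \<ge> 0" "ro \<ge> 0"
  shows "nsq p (mv p (S - S0) v) \<le> (2 * rd\<^sup>2 + 2 * ro\<^sup>2 * (real p)\<^sup>2) * nsq p v"
proof -
  let ?s = "\<Sum>j<p. \<bar>v j\<bar>"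
  have "(mv p (S - S0) v i)\<^sup>2 \<le> 2 * rd\<^sup>2 * (v i)\<^sup>2 + 2 * ro\<^sup>2 * (real p * nsq p v)" if "i < p" for i
  proof -
    have "\<bar>mv p (S - S0) v i\<bar> \<le> (\<Sum>j<p. \<bar>(S - S0) $$ (i, j) * v j\<bar>)"
      unfolding mv_def by (rule sum_abs)
    also have "\<dots> \<le> (\<Sum>j<p. (if j = i then rd * \<bar>v i\<bar> else 0) + ro * \<bar>v j\<bar>)"
    proof (intro sum_mono)
      fix j assume j: "j \<in> {..<p}"
      have "\<bar>(S - S0) $$ (i, j)\<bar> \<le> (if i = j then rd else ro)"
        using near that j S S0 by (auto simp: near_def)
      then have "\<bar>(S - S0) $$ (i, j)\<bar> * \<bar>v j\<bar> \<le> (if i = j then rd else ro) * \<bar>v j\<bar>"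
        by (intro mult_right_mono) auto
      also have "\<dots> \<le> (if j = i then rd * \<bar>v i\<bar> else 0) + ro * \<bar>v j\<bar>"
        using r by auto
      finally show "\<bar>(S - S0) $$ (i, j) * v j\<bar> \<le> (if j = i then rd * \<bar>v i\<bar> else 0) + ro * \<bar>v j\<bar>"
        by (simp add: abs_mult)
    qed
    also have "\<dots> = rd * \<bar>v i\<bar> + ro * ?s"
      using that by (simp add: sum.distrib sum_distrib_left)
    finally have "\<bar>mv p (S - S0) v i\<bar> \<le> rd * \<bar>v i\<bar> + ro * ?s" .
    then have "(mv p (S - S0) v i)\<^sup>2 \<le> (rd * \<bar>v i\<bar> + ro * ?s)\<^sup>2"
      using power_mono[of "\<bar>mv p (S - S0) v i\<bar>" _ 2] by simp
    also have "\<dots> \<le> 2 * (rd * \<bar>v i\<bar>)\<^sup>2 + 2 * (ro * ?s)\<^sup>2"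
      using zero_le_power2[of "rd * \<bar>v i\<bar> - ro * ?s"] unfolding power2_sum power2_diff by linarith
    also have "\<dots> = 2 * rd\<^sup>2 * (v i)\<^sup>2 + 2 * ro\<^sup>2 * ?s\<^sup>2" by (simp add: power_mult_distrib)
    also have "\<dots> \<le> 2 * rd\<^sup>2 * (v i)\<^sup>2 + 2 * ro\<^sup>2 * (real p * nsq p v)"
      by (intro add_left_mono mult_left_mono sum_squared_le_card_nsq) auto
    finally show ?thesis .
  qed
  then have "nsq p (mv p (S - S0) v) \<le> (\<Sum>i<p. 2 * rd\<^sup>2 * (v i)\<^sup>2 + 2 * ro\<^sup>2 * (real p * nsq p v))"
    unfolding nsq_def[of p "mv p (S - S0) v"] by (intro sum_mono) auto
  also have "\<dots> = (2 * rd\<^sup>2 + 2 * ro\<^sup>2 * (real p)\<^sup>2) * nsq p v"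
    by (simp add: sum.distrib sum_distrib_left[symmetric] nsq_def[symmetric])
      (simp add: power2_eq_square algebra_simps)
  finally show ?thesis .
qed

text \<open>Cauchy-Schwarz without square roots: expand |e v - w|^2 \<ge> 0 and |e v + w|^2 \<ge>
  0.\<close>

lemma abs_dot_le:
  assumes "e > 0" "nsq p w \<le> e\<^sup>2 * nsq p v"
  shows "\<bar>dot p v w\<bar> \<le> e * nsq p v"
proof -
  have "0 \<le> nsq p (\<lambda>i. e * v i - w i)" "0 \<le> nsq p (\<lambda>i. e * v i + w i)" by (rule nsq_nonneg)+
  then have "2 * e * \<bar>dot p v w\<bar> \<le> e\<^sup>2 * nsq p v + nsq p w"
    by (auto simp: nsq_eq_dot dot_simps dot_commute[of p w v] power2_eq_square algebra_simps abs_if)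
  also have "\<dots> \<le> 2 * e * (e * nsq p v)" using assms by (simp add: power2_eq_square)
  finally show ?thesis using \<open>e > 0\<close> by simp
qed

lemma near_in_B_eps_Int_U_tau:
  fixes n :: nat
  assumes pd0: "pos_def_mat p S0" and symS: "sym_on p S" and p: "p > 0" and n: "n > 0"
    and \<tau>0: "\<tau>0 > 1" "\<tau>0 < \<tau>"
    and lower: "\<And>v. 1 / \<tau>0 * nsq p v \<le> qf p S0 v" and upper: "\<And>v. qf p S0 v \<le> \<tau>0 * nsq p v"
    and near: "near p S0 S (1 / (8 * \<tau>0 ^ 3 * sqrt n)) (1 / (8 * \<tau>0 ^ 3 * (p * sqrt n)))"
    and gap: "1 / (4 * \<tau>0\<^sup>2 * sqrt n) \<le> 1 - \<tau>0 / \<tau>"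
    and pn: "p \<le> n" and \<epsilon>: "real p / real n < \<epsilon>\<^sup>2"
  shows "S \<in> B_eps p S0 \<epsilon> \<inter> U_tau p \<tau>"
proof -
  \<comment> \<open>The operator norm bound for S - S0. The factor 4 \<tau>0^2 sqrt n is that of
    \<open>gap\<close>; the third \<tau>0 comes from 1/\<tau>0 - 1/\<tau> = (1 -
    \<tau>0/\<tau>)/\<tau>0. The radii satisfy rd = p ro = e/2, so the entrywise estimate gives
    exactly e^2.\<close>
  define e where "e = 1 / (4 * \<tau>0 ^ 3 * sqrt n)"
  define rd where "rd = 1 / (8 * \<tau>0 ^ 3 * sqrt n)"
  define ro where "ro = 1 / (8 * \<tau>0 ^ 3 * (p * sqrt n))"
  have t3: "\<tau>0 ^ 3 > 0" and t3': "\<tau>0 ^ 3 \<ge> \<tau>0" using \<tau>0 self_le_power[of \<tau>0 3] by auto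
  have sn: "sqrt n \<ge> 1" using n by simp
  have e0: "e > 0" using t3 n by (simp add: e_def)
  have Sc: "S \<in> carrier_mat p p" using symS by (simp add: sym_on_def)
  have S0c: "S0 \<in> carrier_mat p p" using pd0 by (rule pos_def_mat_carrier)
  have "rd = e / 2" by (simp add: rd_def e_def)
  moreover have "ro * real p = e / 2" using p by (simp add: ro_def e_def)
  moreover have "2 * rd\<^sup>2 + 2 * ro\<^sup>2 * (real p)\<^sup>2 = 2 * rd\<^sup>2 + 2 * (ro * real p)\<^sup>2"
    by (simp add: power_mult_distrib)
  ultimately have "2 * rd\<^sup>2 + 2 * ro\<^sup>2 * (real p)\<^sup>2 = 2 * (e / 2)\<^sup>2 + 2 * (e / 2)\<^sup>2"
    by (simp only:)
  then have ee: "2 * rd\<^sup>2 + 2 * ro\<^sup>2 * (real p)\<^sup>2 = e\<^sup>2"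
    by (simp add: power_divide)
  have E: "nsq p (mv p (S - S0) v) \<le> e\<^sup>2 * nsq p v" for v
    unfolding ee[symmetric] using near t3
    by (intro nsq_mv_diff_le Sc S0c) (auto simp: rd_def ro_def)
  have qE: "\<bar>qf p S v - qf p S0 v\<bar> \<le> e * nsq p v" for v
  proof -
    have "qf p S v - qf p S0 v = dot p v (mv p (S - S0) v)"
      unfolding qf_eq_dot dot_diff_right[symmetric]
      by (intro dot_cong) (auto simp: mv_minus[OF Sc S0c])
    then show ?thesis using abs_dot_le[OF e0 E] by simp
  qed
  have e1: "e \<le> 1 / (2 * \<tau>0)"
  proof -
    have "2 * \<tau>0 \<le> 4 * \<tau>0 ^ 3 * 1" using t3' \<tau>0 by simp
    also have "\<dots> \<le> 4 * \<tau>0 ^ 3 * sqrt n" using t3 sn by (intro mult_left_mono) auto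
    finally show ?thesis unfolding e_def using \<tau>0 by (intro divide_left_mono) auto
  qed
  have e2: "e \<le> 1 / \<tau>0 - 1 / \<tau>"
  proof -
    have "e = (1 / (4 * \<tau>0\<^sup>2 * sqrt n)) / \<tau>0" by (simp add: e_def power3_eq_cube power2_eq_square)
    also have "\<dots> \<le> (1 - \<tau>0 / \<tau>) / \<tau>0" using gap \<tau>0 by (intro divide_right_mono) auto
    also have "\<dots> = 1 / \<tau>0 - 1 / \<tau>" using \<tau>0 by (simp add: field_simps)
    finally show ?thesis .
  qed
  \<comment> \<open>The margin at the upper end is never the smaller one, since \<tau>0 \<tau> \<ge>
    1.\<close>
  have e3: "e \<le> \<tau> - \<tau>0"
  proof -
    have "1 / \<tau>0 - 1 / \<tau> = (\<tau> - \<tau>0) / (\<tau>0 * \<tau>)" using \<tau>0 by (simp add: field_simps)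
    also have "\<dots> \<le> (\<tau> - \<tau>0) / 1"
      using \<tau>0 less_1_mult[of \<tau>0 \<tau>] by (intro divide_left_mono) auto
    finally show ?thesis using e2 by simp
  qed
  have lowS: "1 / (2 * \<tau>0) * nsq p v \<le> qf p S v" for v
  proof -
    have "1 / (2 * \<tau>0) * nsq p v \<le> (1 / \<tau>0 - e) * nsq p v"
      using e1 by (intro mult_right_mono nsq_nonneg) simp
    also have "\<dots> \<le> qf p S v" using qE[of v] lower[of v] by (simp add: algebra_simps)
    finally show ?thesis .
  qed
  have \<tau>pos: "\<tau> > 0" using \<tau>0 by simp
  have U: "S \<in> U_tau p \<tau>"
    unfolding U_tau_iff_qf[OF symS p \<tau>pos]
  proof (intro allI conjI)
    fix v
    have "1 / \<tau> * nsq p v \<le> (1 / \<tau>0 - e) * nsq p v"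
      using e2 by (intro mult_right_mono nsq_nonneg) simp
    also have "\<dots> \<le> qf p S v" using qE[of v] lower[of v] by (simp add: algebra_simps)
    finally show "1 / \<tau> * nsq p v \<le> qf p S v" .
    have "qf p S v \<le> (\<tau>0 + e) * nsq p v" using qE[of v] upper[of v] by (simp add: algebra_simps)
    also have "\<dots> \<le> \<tau> * nsq p v" using e3 by (intro mult_right_mono nsq_nonneg) simp
    finally show "qf p S v \<le> \<tau> * nsq p v" .
  qed
  then have pd: "pos_def_mat p S" by (simp add: U_tau_def)
  obtain \<Omega> where O: "mat_inverse S = Some \<Omega>" "pos_def_mat p \<Omega>" "S * \<Omega> = 1\<^sub>m p"
    using pos_def_mat_inverse[OF pd] by metis
  \<comment> \<open>The form of \<Omega> is at most 2 \<tau>0 times the squared norm, and trading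
    |v|^2 for the form of \<open>S\<close> costs another 2 \<tau>0. So 1 - \<kappa> has to dominate
    4 \<tau>0^2 e^2, which is at most 1/(4n).\<close>
  define \<kappa> where "\<kappa> = 1 - 1 / (4 * real n)"
  have \<kappa>: "\<kappa> > 0" using n by (simp add: \<kappa>_def field_simps)
  have "4 * \<tau>0\<^sup>2 * e\<^sup>2 \<le> 1 - \<kappa>"
  proof -
    have "1 \<le> \<tau>0 ^ 4" using \<tau>0 by (intro one_le_power) simp
    then have "1 / (4 * \<tau>0 ^ 4 * n) \<le> 1 / (4 * 1 * n)"
      using n \<tau>0 by (intro divide_left_mono mult_right_mono mult_left_mono) auto
    moreover have "4 * \<tau>0\<^sup>2 * e\<^sup>2 = 1 / (4 * \<tau>0 ^ 4 * n)"
      using n \<tau>0 by (simp add: e_def power_divide power_mult_distrib power2_eq_square power3_eq_cube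
          power4_eq_xxxx field_simps)
    ultimately show ?thesis by (simp add: \<kappa>_def)
  qed
  have close: "qf p \<Omega> (mv p (S - S0) v) \<le> (1 - \<kappa>) * qf p S v" for v
  proof -
    have "qf p \<Omega> (mv p (S - S0) v) \<le> nsq p (mv p (S - S0) v) / (1 / (2 * \<tau>0))"
      using \<tau>0 lowS by (intro qf_inverse_le[OF pd pos_def_mat_carrier[OF O(2)] O(3)]) auto
    also have "\<dots> \<le> e\<^sup>2 * nsq p v / (1 / (2 * \<tau>0))"
      using \<tau>0 by (intro divide_right_mono E) auto
    also have "\<dots> = (4 * \<tau>0\<^sup>2 * e\<^sup>2) * (1 / (2 * \<tau>0) * nsq p v)"
      using \<tau>0 by (simp add: power2_eq_square)
    also have "\<dots> \<le> (1 - \<kappa>) * qf p S v"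
      using \<open>4 * \<tau>0\<^sup>2 * e\<^sup>2 \<le> 1 - \<kappa>\<close> lowS \<tau>0 nsq_nonneg[of p v] by (intro mult_mono) (auto simp: \<kappa>_def)
    finally show ?thesis .
  qed
  \<comment> \<open>Bernoulli gives \<kappa>^p \<ge> 1 - p/(4n). Weakening the exponent -1/2 to -1
    and using 1/(1 - x) \<le> 1 + 2x leaves an excess p/(2n), whose double p/n is still strictly
    below \<epsilon>^2.\<close>
  have "(\<kappa> ^ p) powr (-1/2) \<le> 1 + real p / (2 * real n)"
  proof -
    define x where "x = real p / (4 * real n)"
    have x: "0 \<le> x" "x \<le> 1/4" using pn n by (auto simp: x_def field_simps)
    have "1 - x = 1 + real p * (- (1 / (4 * real n)))" by (simp add: x_def)
    also have "\<dots> \<le> (1 + (- (1 / (4 * real n)))) ^ p"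
      using n by (intro Bernoulli_inequality) (simp add: field_simps)
    finally have kp: "1 - x \<le> \<kappa> ^ p" by (simp add: \<kappa>_def)
    have "(\<kappa> ^ p) powr (-1/2) \<le> (1 - x) powr (-1/2)"
      using x kp by (intro powr_mono2') auto
    also have "\<dots> \<le> (1 - x) powr (-1)"
      using x by (intro powr_mono') auto
    also have "\<dots> = 1 / (1 - x)" using x by (simp add: powr_minus_divide)
    also have "\<dots> \<le> 1 + 2 * x"
    proof -
      have "x * (1 - 2 * x) \<ge> 0" using x by (intro mult_nonneg_nonneg) auto
      then show ?thesis using x by (simp add: divide_le_eq algebra_simps)
    qed
    finally show ?thesis by (simp add: x_def)
  qed
  then have "S \<in> B_eps p S0 \<epsilon>"
    using \<epsilon> by (intro B_eps_if_close[OF pd0 pd \<kappa> O(1) close, of "real p / (2 * real n)"]) auto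
  with U show ?thesis by simp
qed

section \<open>Measurability\<close>

lemma measurable_det:
  fixes A :: "'a \<Rightarrow> real mat"
  assumes c: "\<And>x. A x \<in> carrier_mat p p"
    and m: "\<And>i j. i < p \<Longrightarrow> j < p \<Longrightarrow> (\<lambda>x. A x $$ (i, j)) \<in> borel_measurable M"
  shows "(\<lambda>x. det (A x)) \<in> borel_measurable M"
  unfolding det_def'[OF c]
proof (intro borel_measurable_sum borel_measurable_times borel_measurable_const borel_measurable_prod)
  fix q i assume "q \<in> {q. q permutes {0..<p}}" "i \<in> {0..<p}"
  then show "(\<lambda>x. A x $$ (i, q i)) \<in> borel_measurable M"
    using permutes_in_image[of q "{0..<p}" i] by (intro m) auto
qed

lemma measurable_adj_mat:
  fixes A :: "'a \<Rightarrow> real mat"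
  assumes c: "\<And>x. A x \<in> carrier_mat p p"
    and m: "\<And>i j. i < p \<Longrightarrow> j < p \<Longrightarrow> (\<lambda>x. A x $$ (i, j)) \<in> borel_measurable M"
    and ij: "i < p" "j < p"
  shows "(\<lambda>x. adj_mat (A x) $$ (i, j)) \<in> borel_measurable M"
proof -
  have dim: "dim_row (A x) = p" "dim_col (A x) = p" for x using c[of x] by auto
  have "(\<lambda>x. det (mat_delete (A x) j i)) \<in> borel_measurable M"
  proof (rule measurable_det[of _ "p - 1"])
    show "mat_delete (A x) j i \<in> carrier_mat (p - 1) (p - 1)" for x
      using c by (rule mat_delete_carrier)
    fix k l assume kl: "k < p - 1" "l < p - 1"
    have "(\<lambda>x. mat_delete (A x) j i $$ (k, l)) =
        (\<lambda>x. A x $$ (if k < j then k else Suc k, if l < i then l else Suc l))"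
      using kl by (simp add: mat_delete_def dim)
    also have "\<dots> \<in> borel_measurable M" using kl by (intro m) auto
    finally show "(\<lambda>x. mat_delete (A x) j i $$ (k, l)) \<in> borel_measurable M" .
  qed
  moreover have "(\<lambda>x. adj_mat (A x) $$ (i, j)) = (\<lambda>x. (-1) ^ (j + i) * det (mat_delete (A x) j i))"
    using ij by (simp add: adj_mat_def dim cofactor_def)
  ultimately show ?thesis by simp
qed

lemma qf_inverse_eq_adj_mat:
  assumes "S \<in> carrier_mat p p" "B \<in> carrier_mat p p" "B * S = 1\<^sub>m p"
  shows "det S * qf p B y = qf p (adj_mat S) y"
proof -
  note adj = adj_mat[OF assms(1)]
  have "adj_mat S = (B * S) * adj_mat S" using assms adj by simp
  also have "\<dots> = B * (S * adj_mat S)"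
    using assms adj by (intro assoc_mult_mat[of _ p p _ p _ p]) auto
  also have "\<dots> = det S \<cdot>\<^sub>m B"
    unfolding adj using assms by (simp add: mult_smult_distrib[of _ p p _ p])
  finally show ?thesis using assms by (simp add: qf_smult)
qed

text \<open>The density is defined through \<open>mat_inverse\<close>, an elimination algorithm that
  branches on its input. By Cramer's rule the inverse is the adjugate over the determinant, both
  polynomial in the entries, which makes the density jointly measurable in matrix and point.\<close>

lemma gauss_dens_eq_adj_mat:
  assumes "pos_def_mat p S"
  shows "gauss_dens p S y =
    (2 * pi) powr (- real p / 2) * det S powr (-1/2) * exp (- 1/2 * (qf p (adj_mat S) y / det S))"
proof -
  obtain B where B: "mat_inverse S = Some B" "pos_def_mat p B" "B * S = 1\<^sub>m p"
    using pos_def_mat_inverse[OF assms] by metis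
  have "det S > 0" using gauss_integral[OF assms] by simp
  then have "qf p B y = qf p (adj_mat S) y / det S"
    using qf_inverse_eq_adj_mat[OF _ _ B(3), of y] assms B(2) pos_def_mat_carrier
    by (simp add: field_simps)
  then show ?thesis
    using gauss_dens_eq_qf[OF B(1) pos_def_mat_carrier[OF B(2)]] by simp
qed

lemma sym_mat_carrier: "sym_mat p x \<in> carrier_mat p p"
  by (simp add: sym_mat_def)

lemma sym_on_sym_mat: "sym_on p (sym_mat p x)"
  by (auto simp: sym_on_def sym_mat_def)

lemma sym_mat_index: "i < p \<Longrightarrow> j < p \<Longrightarrow> sym_mat p x $$ (i, j) = (if i \<le> j then x (i, j) else x (j, i))"
  by (simp add: sym_mat_def)

abbreviation upper_pairs :: "nat \<Rightarrow> (nat \<times> nat) set" where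
  "upper_pairs p \<equiv> {(j, k). j \<le> k \<and> k < p}"

lemma measurable_sym_mat_index:
  assumes "i < p" "j < p"
  shows "(\<lambda>x. sym_mat p x $$ (i, j)) \<in> borel_measurable (PiM (upper_pairs p) (\<lambda>_. borel))"
proof -
  have "(\<lambda>x. x (if i \<le> j then (i, j) else (j, i))) \<in> borel_measurable (PiM (upper_pairs p) (\<lambda>_. borel :: real measure))"
    using assms by (intro measurable_component_singleton) auto
  then show ?thesis using assms by (simp add: sym_mat_index if_distrib[of "\<lambda>ij. x ij" for x])
qed

text \<open>
  Measurability cannot be bypassed: \<^const>\<open>measure\<close> is 0 on non-measurable sets, so the events in
  \<^const>\<open>prior_prob\<close> must be shown measurable before a box inside them bounds their probability.
  The constraint quantifies over uncountably many vectors, so the set is obtained as a closed set of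
  functions on all of \<open>nat \<times> nat\<close>.
\<close>

lemma sets_U_tau:
  assumes p: "p > 0" and \<tau>: "\<tau> > 0"
  shows "{x \<in> space (PiM (upper_pairs p) (\<lambda>_. borel)). sym_mat p x \<in> U_tau p \<tau>}
    \<in> sets (PiM (upper_pairs p) (\<lambda>_. borel))" (is "_ \<in> sets ?N")
proof -
  define C :: "(nat \<times> nat \<Rightarrow> real) set" where "C = {x. sym_mat p x \<in> U_tau p \<tau>}"
  \<comment> \<open>A point of the product space is \<open>undefined\<close> outside the index set.
    Filling in 0 maps it measurably into the full function space, where Borel sets and product sets
    coincide as the index type is countable; the matrix is unaffected.\<close>
  define \<phi> :: "(nat \<times> nat \<Rightarrow> real) \<Rightarrow> nat \<times> nat \<Rightarrow> real" where "\<phi> x = (\<lambda>ij. if ij \<in> upper_pairs p then x ij else 0)" for x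
  have cont: "continuous_on UNIV (\<lambda>x. qf p (sym_mat p x) v)" for v
  proof -
    have *: "qf p (sym_mat p x) v = (\<Sum>i<p. \<Sum>j<p. x (if i \<le> j then (i, j) else (j, i)) * v i * v j)" for x
      unfolding qf_def by (intro sum.cong) (auto simp: sym_mat_index)
    show ?thesis unfolding *
      by (intro continuous_intros continuous_on_product_coordinates)
  qed
  have "C = {x. \<forall>v. 1 / \<tau> * nsq p v \<le> qf p (sym_mat p x) v \<and> qf p (sym_mat p x) v \<le> \<tau> * nsq p v}"
    unfolding C_def U_tau_iff_qf[OF sym_on_sym_mat p \<tau>] ..
  also have "closed \<dots>"
    by (intro closed_Collect_all closed_Collect_conj closed_Collect_le cont continuous_on_const)
  finally have C: "C \<in> sets borel" by (rule borel_closed)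
  have "\<phi> \<in> measurable ?N (PiM UNIV (\<lambda>_. borel))"
  proof (rule measurable_PiM_single')
    fix ij :: "nat \<times> nat"
    show "(\<lambda>x. \<phi> x ij) \<in> borel_measurable ?N"
      by (cases "ij \<in> upper_pairs p") (simp_all add: \<phi>_def)
  qed auto
  then have \<phi>: "\<phi> \<in> measurable ?N borel"
    by (simp add: measurable_cong_sets[OF refl sets_PiM_equal_borel])
  have "sym_mat p (\<phi> x) = sym_mat p x" for x
    by (rule eq_matI) (auto simp: sym_mat_def \<phi>_def)
  then have "{x \<in> space ?N. sym_mat p x \<in> U_tau p \<tau>} = \<phi> -` C \<inter> space ?N"
    by (auto simp: C_def)
  also have "\<dots> \<in> sets ?N" using \<phi> C by (rule measurable_sets)
  finally show ?thesis .
qed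

lemma measurable_gauss_form:
  fixes D Q :: "'a \<Rightarrow> real"
  assumes [measurable]: "D \<in> borel_measurable M" "Q \<in> borel_measurable M"
  shows "(\<lambda>z. c * D z powr a * exp (b * (Q z / D z))) \<in> borel_measurable M"
  by measurable

lemma measurable_ln_ratio:
  fixes f g :: "'a \<Rightarrow> real"
  assumes [measurable]: "f \<in> borel_measurable M" "g \<in> borel_measurable M"
  shows "(\<lambda>z. f z * ln (f z / g z)) \<in> borel_measurable M"
    and "(\<lambda>z. f z * (ln (f z / g z))\<^sup>2) \<in> borel_measurable M"
  by measurable

text \<open>The explicit formula \<open>g\<close> is measurable for every argument but agrees with
  the density only at positive definite matrices. Inside \<open>U_tau\<close> this holds, so the
  event is a measurable set cut by two sublevel sets of parameter integrals.\<close>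

lemma sets_B_eps_Int_U_tau:
  assumes p: "p > 0" and \<tau>: "\<tau> > 0" and pd0: "pos_def_mat p S0"
  shows "{x \<in> space (PiM (upper_pairs p) (\<lambda>_. borel)). sym_mat p x \<in> B_eps p S0 \<epsilon> \<inter> U_tau p \<tau>}
    \<in> sets (PiM (upper_pairs p) (\<lambda>_. borel))" (is "_ \<in> sets ?N")
proof -
  interpret L: product_sigma_finite "\<lambda>_::nat. lborel :: real measure" by standard
  interpret L: sigma_finite_measure "lborel_p p" by (rule L.sigma_finite) simp
  let ?d = "\<lambda>x. det (sym_mat p x)"
  define g where "g x y = (2 * pi) powr (- real p / 2) * ?d x powr (-1/2) *
    exp (- 1/2 * (qf p (adj_mat (sym_mat p x)) y / ?d x))" for x y
  have d: "?d \<in> borel_measurable ?N"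
    by (rule measurable_det[OF sym_mat_carrier measurable_sym_mat_index])
  have q: "(\<lambda>z. qf p (adj_mat (sym_mat p (fst z))) (snd z)) \<in> borel_measurable (?N \<Otimes>\<^sub>M lborel_p p)"
  proof (rule measurable_qf)
    fix i j assume "i < p" "j < p"
    then have "(\<lambda>x. adj_mat (sym_mat p x) $$ (i, j)) \<in> borel_measurable ?N"
      by (intro measurable_adj_mat[OF sym_mat_carrier measurable_sym_mat_index])
    then show "(\<lambda>z. adj_mat (sym_mat p (fst z)) $$ (i, j)) \<in> borel_measurable (?N \<Otimes>\<^sub>M lborel_p p)"
      by (rule measurable_compose[OF measurable_fst])
  next
    fix i assume "i < p"
    then have "(\<lambda>y. y i) \<in> borel_measurable (lborel_p p)" by simp
    then show "(\<lambda>z. snd z i) \<in> borel_measurable (?N \<Otimes>\<^sub>M lborel_p p)"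
      by (rule measurable_compose[OF measurable_snd])
  qed
  have f0: "(\<lambda>z. gauss_dens p S0 (snd z)) \<in> borel_measurable (?N \<Otimes>\<^sub>M lborel_p p)"
    by (rule measurable_compose[OF measurable_snd measurable_gauss_dens[OF pd0]])
  have g: "(\<lambda>z. g (fst z) (snd z)) \<in> borel_measurable (?N \<Otimes>\<^sub>M lborel_p p)"
    unfolding g_def
    by (rule measurable_gauss_form[OF measurable_compose[OF measurable_fst d] q])
  have K: "(\<lambda>x. \<integral>y. gauss_dens p S0 y * ln (gauss_dens p S0 y / g x y) \<partial>lborel_p p) \<in> borel_measurable ?N"
    using measurable_ln_ratio(1)[OF f0 g]
    by (intro L.borel_measurable_lebesgue_integral) (simp add: split_beta)
  have V: "(\<lambda>x. \<integral>y. gauss_dens p S0 y * (ln (gauss_dens p S0 y / g x y))\<^sup>2 \<partial>lborel_p p) \<in> borel_measurable ?N"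
    using measurable_ln_ratio(2)[OF f0 g]
    by (intro L.borel_measurable_lebesgue_integral) (simp add: split_beta)
  have "{x \<in> space ?N. sym_mat p x \<in> B_eps p S0 \<epsilon> \<inter> U_tau p \<tau>} =
    {x \<in> space ?N. sym_mat p x \<in> U_tau p \<tau>} \<inter>
    {x \<in> space ?N. (\<integral>y. gauss_dens p S0 y * ln (gauss_dens p S0 y / g x y) \<partial>lborel_p p) < \<epsilon>\<^sup>2} \<inter>
    {x \<in> space ?N. (\<integral>y. gauss_dens p S0 y * (ln (gauss_dens p S0 y / g x y))\<^sup>2 \<partial>lborel_p p) < \<epsilon>\<^sup>2}"
  proof -
    have "KL_gauss p S0 (sym_mat p x) = (\<integral>y. gauss_dens p S0 y * ln (gauss_dens p S0 y / g x y) \<partial>lborel_p p)"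
      "V_gauss p S0 (sym_mat p x) = (\<integral>y. gauss_dens p S0 y * (ln (gauss_dens p S0 y / g x y))\<^sup>2 \<partial>lborel_p p)"
      if "sym_mat p x \<in> U_tau p \<tau>" for x
      using that unfolding KL_gauss_def V_gauss_def g_def
      by (simp_all only: U_tau_def mem_Collect_eq gauss_dens_eq_adj_mat)
    then show ?thesis by (auto simp: B_eps_def U_tau_def)
  qed
  also have "\<dots> \<in> sets ?N"
    using sets_U_tau[OF p \<tau>] borel_measurable_less[OF K borel_measurable_const]
      borel_measurable_less[OF V borel_measurable_const]
    by (intro sets.Int) auto
  finally show ?thesis .
qed

text \<open>Independence factorises the box. The normalising constant of the truncated prior is a
  probability, so dividing by it can only increase the bound.\<close>

lemma prior_prob_ge_prod:
  fixes X :: "nat \<times> nat \<Rightarrow> real set"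
  assumes p: "p > 0" and \<tau>: "\<tau> > 0" and pd0: "pos_def_mat p S0"
    and diag: "prob_space (diag_law lam)" and off: "prob_space (offdiag_law a b \<tau>1)"
    and X: "\<And>ij. X ij \<in> sets borel"
    and sub: "\<And>x. (\<And>ij. ij \<in> upper_pairs p \<Longrightarrow> x ij \<in> X ij) \<Longrightarrow> sym_mat p x \<in> B_eps p S0 \<epsilon> \<inter> U_tau p \<tau>"
  shows "prior_prob p \<tau> a b \<tau>1 lam (B_eps p S0 \<epsilon>) \<ge>
    (\<Prod>(j, k)\<in>upper_pairs p. measure (if j = k then diag_law lam else offdiag_law a b \<tau>1) (X (j, k)))"
proof -
  define M :: "nat \<times> nat \<Rightarrow> real measure" where "M = (\<lambda>(j, k). if j = k then diag_law lam else offdiag_law a b \<tau>1)"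
  have prob: "prob_space (M ij)" for ij using diag off by (cases ij) (auto simp: M_def)
  have fin: "finite (upper_pairs p)"
    by (rule finite_subset[of _ "{..<p} \<times> {..<p}"]) auto
  interpret product_prob_space M "upper_pairs p" by (rule product_prob_spaceI) (rule prob)
  interpret finite_product_prob_space M "upper_pairs p" by standard (rule fin)
  have sM: "sets (M ij) = sets borel" for ij
    by (cases ij) (auto simp: M_def diag_law_def offdiag_law_def)
  define P where "P = prior_u p a b \<tau>1 lam"
  have P: "P = PiM (upper_pairs p) M" by (simp add: P_def prior_u_def M_def)
  have sP: "sets P = sets (PiM (upper_pairs p) (\<lambda>_. borel))"
    unfolding P by (intro sets_PiM_cong sM refl)
  note spP = sets_eq_imp_space_eq[OF sP]
  interpret Q: prob_space P unfolding P by unfold_locales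
  let ?A = "{x \<in> space P. sym_mat p x \<in> B_eps p S0 \<epsilon> \<inter> U_tau p \<tau>}"
  let ?U = "{x \<in> space P. sym_mat p x \<in> U_tau p \<tau>}"
  have A: "?A \<in> sets P" unfolding sP spP by (rule sets_B_eps_Int_U_tau[OF p \<tau> pd0])
  have U: "?U \<in> sets P" unfolding sP spP by (rule sets_U_tau[OF p \<tau>])
  have "(\<Prod>ij\<in>upper_pairs p. measure (M ij) (X ij)) = measure P (PiE (upper_pairs p) X)"
    unfolding P by (rule prob_times[symmetric]) (simp add: sM X)
  also have "\<dots> \<le> measure P ?A"
  proof (rule Q.finite_measure_mono)
    have "x \<in> space P" if "x \<in> PiE (upper_pairs p) X" for x
      using that unfolding spP space_PiM by auto
    then show "PiE (upper_pairs p) X \<subseteq> ?A"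
      using sub by (auto simp: PiE_iff)
  qed (rule A)
  finally have 1: "(\<Prod>ij\<in>upper_pairs p. measure (M ij) (X ij)) \<le> measure P ?A" .
  have 2: "measure P ?A \<le> measure P ?U" by (intro Q.finite_measure_mono U) auto
  \<comment> \<open>If the denominator is 0, the quotient is 0 by convention, but the numerator is
    then 0 as well.\<close>
  have "measure P ?A \<le> measure P ?A / measure P ?U"
  proof (cases "measure P ?U = 0")
    case True
    then show ?thesis using 2 measure_nonneg[of P ?A] by simp
  next
    case False
    then have "0 < measure P ?U" using measure_nonneg[of P ?U] by linarith
    moreover have "measure P ?A * measure P ?U \<le> measure P ?A * 1"
      by (intro mult_left_mono Q.prob_le_1 measure_nonneg)
    ultimately show ?thesis by (simp only: pos_le_divide_eq mult_1_right)
  qed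
  with 1 show ?thesis unfolding prior_prob_def P_def[symmetric]
    by (simp add: M_def split_beta)
qed

section \<open>Marginal laws of the prior\<close>

text \<open>The exponential density decreases, so on the interval it is at least its value at
  \<open>b\<close>.\<close>

lemma measure_diag_law_ge:
  assumes "lam > 0" "0 \<le> a" "a \<le> b"
  shows "(b - a) * (lam / 2 * exp (- (b * lam / 2))) \<le> measure (diag_law lam) {a..b}"
proof -
  interpret prob_space "diag_law lam"
    unfolding diag_law_def using assms by (intro prob_space_exponential_density) simp
  let ?c = "lam / 2 * exp (- (b * lam / 2))"
  have "ennreal ((b - a) * ?c) = (\<integral>\<^sup>+x. ennreal ?c * indicator {a..b} x \<partial>lborel)"
    using assms by (subst nn_integral_cmult_indicator) (auto simp: ennreal_mult[symmetric] mult.commute)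
  also have "\<dots> \<le> (\<integral>\<^sup>+x. ennreal (erlang_density 0 (lam / 2) x) * indicator {a..b} x \<partial>lborel)"
  proof (intro nn_integral_mono)
    fix x
    have "?c \<le> erlang_density 0 (lam / 2) x" if "x \<in> {a..b}"
      using that assms by (auto simp: exponential_density_def)
    then show "ennreal ?c * indicator {a..b} x \<le> ennreal (erlang_density 0 (lam / 2) x) * indicator {a..b} x"
      by (auto simp: ennreal_leI split: split_indicator)
  qed
  also have "\<dots> = emeasure (diag_law lam) {a..b}"
    unfolding diag_law_def by (subst emeasure_density) auto
  also have "\<dots> = ennreal (measure (diag_law lam) {a..b})" by (rule emeasure_eq_measure)
  finally show ?thesis by (simp add: ennreal_le_iff)
qed

section \<open>The off-diagonal marginal, a horseshoe law of scale t\<close>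

definition joint_dens :: "real \<Rightarrow> real \<Rightarrow> real \<Rightarrow> real" where
  "joint_dens t r s = beta_density (1/2) (1/2) r * normal_density 0 (sqrt (r / (1 - r) * t\<^sup>2)) s"

lemma measurable_joint_dens[measurable]:
  "(\<lambda>(r, s). joint_dens t r s) \<in> borel_measurable (lborel \<Otimes>\<^sub>M lborel)"
  unfolding joint_dens_def beta_density_def normal_density_def split_beta by measurable

lemma Beta_half_half: "Beta (1/2) (1/2) = (pi :: real)"
  by (simp add: Beta_def Gamma_one_half_real)

text \<open>At a = b = 1/2 the square roots of the Beta density and of the normal normalisation
  combine to 1/r, and the exponent is linear in 1/r; this keeps both marginal bounds elementary.
  Only the square of \<open>\<tau>1\<close> is controlled, hence the absolute value of
  \<open>t\<close>.\<close>

lemma joint_dens_eq: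
  assumes "0 < r" "r < 1" "t \<noteq> 0"
  shows "joint_dens t r s =
    1 / (pi * sqrt (2 * pi) * \<bar>t\<bar>) * (1 / r) * exp (- (s\<^sup>2 / (2 * t\<^sup>2)) * (1 / r - 1))"
proof -
  have 1: "r powr (1/2 - 1) = 1 / sqrt r" "(1 - r) powr (1/2 - 1) = 1 / sqrt (1 - r)"
    using assms powr_minus_half[of r] powr_minus_half[of "1 - r"] by simp_all
  have 2: "sqrt (2 * pi * (sqrt (r / (1 - r) * t\<^sup>2))\<^sup>2) = sqrt (2 * pi) * sqrt r * \<bar>t\<bar> / sqrt (1 - r)"
    using assms by (simp add: real_sqrt_mult real_sqrt_divide)
  have 3: "- (s - 0)\<^sup>2 / (2 * (sqrt (r / (1 - r) * t\<^sup>2))\<^sup>2) = - (s\<^sup>2 / (2 * t\<^sup>2)) * (1 / r - 1)"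
    using assms by (simp add: field_simps)
  have 4: "beta_density (1/2) (1/2) r = 1 / sqrt r * (1 / sqrt (1 - r)) / pi"
    unfolding beta_density_def 1 Beta_half_half using assms by simp
  have "1 / sqrt r * (1 / sqrt (1 - r)) / pi * (1 / (sqrt (2 * pi) * sqrt r * \<bar>t\<bar> / sqrt (1 - r))) =
      1 / (pi * sqrt (2 * pi) * \<bar>t\<bar>) * (1 / (sqrt r * sqrt r))"
    using assms by simp
  also have "sqrt r * sqrt r = r" using assms by simp
  finally show ?thesis
    unfolding joint_dens_def normal_density_def 2 3 4 by (simp only: mult.assoc[symmetric])
qed

text \<open>Both orders of integration are used: the first exhibits the marginal density of an
  entry, the second integrates out the normal variable and reduces the total mass to that of the
  Beta law.\<close>

lemma emeasure_offdiag_law: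
  assumes "A \<in> sets borel"
  shows "emeasure (offdiag_law (1/2) (1/2) t) A =
    (\<integral>\<^sup>+s. (\<integral>\<^sup>+r. ennreal (joint_dens t r s) \<partial>lborel) * indicator A s \<partial>lborel)" (is ?t1)
   and "emeasure (offdiag_law (1/2) (1/2) t) A =
    (\<integral>\<^sup>+r. (\<integral>\<^sup>+s. ennreal (joint_dens t r s) * indicator A s \<partial>lborel) \<partial>lborel)" (is ?t2)
proof -
  note [measurable] = assms
  have eq: "offdiag_law (1/2) (1/2) t =
      distr (density (lborel \<Otimes>\<^sub>M lborel) (\<lambda>z. ennreal (joint_dens t (fst z) (snd z)))) lborel snd"
    unfolding offdiag_law_def joint_dens_def case_prod_unfold ..
  have [measurable]: "(\<lambda>z. ennreal (joint_dens t (fst z) (snd z)) * indicator A (snd z))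
      \<in> borel_measurable (lborel \<Otimes>\<^sub>M lborel)"
    using measurable_joint_dens[of t] unfolding split_beta by measurable
  have md: "(\<lambda>z. ennreal (joint_dens t (fst z) (snd z))) \<in> borel_measurable (lborel \<Otimes>\<^sub>M lborel)"
    using measurable_joint_dens[of t] unfolding split_beta by measurable
  have S: "snd -` A \<inter> space (lborel \<Otimes>\<^sub>M lborel) \<in> sets (lborel \<Otimes>\<^sub>M lborel :: (real \<times> real) measure)"
    using assms by (intro measurable_sets[OF measurable_snd]) simp
  have "emeasure (offdiag_law (1/2) (1/2) t) A =
      emeasure (density (lborel \<Otimes>\<^sub>M lborel) (\<lambda>z. ennreal (joint_dens t (fst z) (snd z))))
        (snd -` A \<inter> space (lborel \<Otimes>\<^sub>M lborel))"
    unfolding eq using assms by (subst emeasure_distr) (auto simp: measurable_snd)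
  also have "\<dots> = (\<integral>\<^sup>+z. ennreal (joint_dens t (fst z) (snd z)) *
      indicator (snd -` A \<inter> space (lborel \<Otimes>\<^sub>M lborel)) z \<partial>(lborel \<Otimes>\<^sub>M lborel))"
    by (rule emeasure_density[OF md S])
  also have "\<dots> = (\<integral>\<^sup>+z. ennreal (joint_dens t (fst z) (snd z)) * indicator A (snd z) \<partial>(lborel \<Otimes>\<^sub>M lborel))"
    by (intro nn_integral_cong) (auto simp: space_pair_measure split: split_indicator)
  finally have *: "emeasure (offdiag_law (1/2) (1/2) t) A = \<dots>" .
  show ?t1 unfolding *
    by (subst lborel_pair.nn_integral_snd[symmetric]) (auto simp: nn_integral_multc)
  show ?t2 unfolding *
    by (subst lborel.nn_integral_fst[symmetric]) auto
qed

lemma prob_space_offdiag_law: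
  assumes t: "t \<noteq> 0"
  shows "prob_space (offdiag_law (1/2) (1/2) t)"
proof (rule prob_spaceI)
  have sp: "space (offdiag_law (1/2) (1/2) t) = UNIV" by (simp add: offdiag_law_def)
  have "emeasure (offdiag_law (1/2) (1/2) t) UNIV =
      (\<integral>\<^sup>+r. (\<integral>\<^sup>+s. ennreal (joint_dens t r s) * indicator UNIV s \<partial>lborel) \<partial>lborel)"
    by (rule emeasure_offdiag_law) simp
  also have "\<dots> = (\<integral>\<^sup>+r. ennreal (beta_density (1/2) (1/2) r) \<partial>lborel)"
  proof (intro nn_integral_cong)
    fix r :: real
    show "(\<integral>\<^sup>+s. ennreal (joint_dens t r s) * indicator UNIV s \<partial>lborel) = ennreal (beta_density (1/2) (1/2) r)"
    proof (cases "0 < r \<and> r < 1")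
      case True
      then have v: "sqrt (r / (1 - r) * t\<^sup>2) > 0" using t by simp
      have b: "beta_density (1/2) (1/2) r \<ge> 0" by (simp add: beta_density_def Beta_half_half)
      have "(\<integral>\<^sup>+s. ennreal (joint_dens t r s) * indicator UNIV s \<partial>lborel) =
        (\<integral>\<^sup>+s. ennreal (beta_density (1/2) (1/2) r) * ennreal (normal_density 0 (sqrt (r / (1 - r) * t\<^sup>2)) s) \<partial>lborel)"
        unfolding joint_dens_def using b by (simp add: ennreal_mult)
      also have "\<dots> = ennreal (beta_density (1/2) (1/2) r) *
          (\<integral>\<^sup>+s. ennreal (normal_density 0 (sqrt (r / (1 - r) * t\<^sup>2)) s) \<partial>lborel)"
        by (rule nn_integral_cmult) simp
      also have "(\<integral>\<^sup>+s. ennreal (normal_density 0 (sqrt (r / (1 - r) * t\<^sup>2)) s) \<partial>lborel) = 1"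
        using integral_normal_density[OF v, of 0] integrable_normal_density[OF v, of 0]
        by (subst nn_integral_eq_integral) auto
      finally show ?thesis by simp
    qed (auto simp: joint_dens_def beta_density_def)
  qed
  also have "\<dots> = 1"
  proof -
    have "((\<lambda>t. t powr (1/2 - 1) * (1 - t) powr (1/2 - 1) / pi) has_integral pi / pi) {0<..<1::real}"
      using has_integral_Beta_real[of "1/2" "1/2"]
      by (intro has_integral_divide) (simp add: has_integral_Icc_iff_Ioo Beta_half_half)
    then have "(beta_density (1/2) (1/2) has_integral 1) {0<..<1}"
      by (rule has_integral_eq[rotated, THEN has_integral_eq_rhs])
        (auto simp: beta_density_def Beta_half_half)
    then have "((\<lambda>x. if x \<in> {0<..<1} then beta_density (1/2) (1/2) x else 0) has_integral 1) UNIV"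
      by (simp only: has_integral_restrict_UNIV)
    moreover have "(\<lambda>x. if x \<in> {0<..<1} then beta_density (1/2) (1/2) x else 0) = beta_density (1/2) (1/2)"
      by (auto simp: beta_density_def)
    ultimately have "(beta_density (1/2) (1/2) has_integral 1) UNIV" by simp
    then have "(\<integral>\<^sup>+x. ennreal (beta_density (1/2) (1/2) x) \<partial>lborel) = ennreal 1"
      by (intro nn_integral_has_integral_lborel) (auto simp: beta_density_def[abs_def] Beta_half_half)
    then show ?thesis by simp
  qed
  finally show "emeasure (offdiag_law (1/2) (1/2) t) (space (offdiag_law (1/2) (1/2) t)) = 1"
    unfolding sp .
qed

lemma sqrt_two_pi_bounds: "2 \<le> sqrt (2 * pi)" "sqrt (2 * pi) \<le> 2.83"
proof -
  show "2 \<le> sqrt (2 * pi)" using pi_gt3 by (intro real_le_rsqrt) simp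
  show "sqrt (2 * pi) \<le> 2.83"
    using pi_less_4 by (intro real_le_lsqrt) (simp_all add: power2_eq_square)
qed

text \<open>The mass comes from \<open>r\<close> close to 1, where the normal variance is at least
  T^2/2. A stretch of length t^2/T^2 there, times the constant of order 1/|t|, bounds the marginal
  density below by order |t|/T^2 on all of [-T, T].\<close>

lemma measure_offdiag_law_ge:
  assumes t: "t \<noteq> 0" and T: "T > 0" "t\<^sup>2 \<le> T\<^sup>2 / 2" and ab: "- T \<le> a" "a \<le> b" "b \<le> T"
  shows "(b - a) * (\<bar>t\<bar> / (32 * T\<^sup>2)) \<le> measure (offdiag_law (1/2) (1/2) t) {a..b}"
proof -
  interpret prob_space "offdiag_law (1/2) (1/2) t" by (rule prob_space_offdiag_law[OF t])
  \<comment> \<open>With 1/r - 1 \<le> 2 w on the stretch, this keeps the exponent above -1, since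
    T^2/(2 t^2) * 2 w = 1.\<close>
  define w where "w = t\<^sup>2 / T\<^sup>2"
  have w: "0 < w" "w \<le> 1/2" using t T by (auto simp: w_def field_simps)
  define c where "c = 1 / (pi * sqrt (2 * pi) * \<bar>t\<bar>)"
  have c: "c > 0" using t by (simp add: c_def)
  have dens: "ennreal (\<bar>t\<bar> / (32 * T\<^sup>2)) \<le> (\<integral>\<^sup>+r. ennreal (joint_dens t r s) \<partial>lborel)"
    if s: "s \<in> {a..b}" for s
  proof -
    have sT: "s\<^sup>2 \<le> T\<^sup>2" using s ab by (intro abs_le_square_iff[THEN iffD1]) auto
    have pt: "c * exp (- 1) \<le> joint_dens t r s" if r: "r \<in> {1 - w<..<1}" for r
    proof -
      have r': "0 < r" "1/2 \<le> r" "r < 1" using r w by auto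
      have "1 / r - 1 = (1 - r) / r" using r' by (simp add: field_simps)
      also have "\<dots> \<le> w / (1/2)" using r r' by (intro frac_le) auto
      finally have "s\<^sup>2 / (2 * t\<^sup>2) * (1 / r - 1) \<le> T\<^sup>2 / (2 * t\<^sup>2) * (2 * w)"
        using sT t w r' by (intro mult_mono divide_right_mono) auto
      also have "\<dots> = 1" using t T by (simp add: w_def)
      finally have "exp (- 1) \<le> exp (- (s\<^sup>2 / (2 * t\<^sup>2)) * (1 / r - 1))" by simp
      moreover have "1 \<le> 1 / r" using r' by simp
      ultimately have "1 * exp (-1) \<le> (1 / r) * exp (- (s\<^sup>2 / (2 * t\<^sup>2)) * (1 / r - 1))"
        using r' by (intro mult_mono) auto
      then have "c * exp (-1) \<le> c * ((1 / r) * exp (- (s\<^sup>2 / (2 * t\<^sup>2)) * (1 / r - 1)))"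
        using c by (intro mult_left_mono) auto
      then show ?thesis using r' t unfolding c_def by (subst joint_dens_eq) (auto simp: mult.assoc)
    qed
    \<comment> \<open>4 * 2.83 * 2.72 is just below 31, whence the constant 32.\<close>
    have "pi * sqrt (2 * pi) * exp 1 \<le> 4 * 2.83 * 2.72"
      using sqrt_two_pi_bounds pi_less_4 e_less_272 by (intro mult_mono) auto
    then have le32: "pi * sqrt (2 * pi) * exp 1 \<le> 32" by simp
    have "\<bar>t\<bar> / (32 * T\<^sup>2) \<le> \<bar>t\<bar> / (pi * sqrt (2 * pi) * exp 1 * T\<^sup>2)"
      using le32 T t by (intro divide_left_mono mult_right_mono) auto
    also have "\<dots> = c * exp (-1) * w"
      using t T by (simp add: c_def w_def exp_minus power2_eq_square field_simps)
    finally have "ennreal (\<bar>t\<bar> / (32 * T\<^sup>2)) \<le> ennreal (c * exp (-1) * w)" by (rule ennreal_leI)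
    also have "\<dots> = (\<integral>\<^sup>+r. ennreal (c * exp (-1)) * indicator {1 - w<..<1} r \<partial>lborel)"
      using w c by (subst nn_integral_cmult_indicator) (auto simp: ennreal_mult[symmetric])
    also have "\<dots> \<le> (\<integral>\<^sup>+r. ennreal (joint_dens t r s) \<partial>lborel)"
      using pt by (intro nn_integral_mono) (auto simp: ennreal_leI split: split_indicator)
    finally show ?thesis .
  qed
  have "ennreal ((b - a) * (\<bar>t\<bar> / (32 * T\<^sup>2))) = (\<integral>\<^sup>+s. ennreal (\<bar>t\<bar> / (32 * T\<^sup>2)) * indicator {a..b} s \<partial>lborel)"
    using ab by (subst nn_integral_cmult_indicator) (auto simp: ennreal_mult[symmetric] mult.commute)
  also have "\<dots> \<le> (\<integral>\<^sup>+s. (\<integral>\<^sup>+r. ennreal (joint_dens t r s) \<partial>lborel) * indicator {a..b} s \<partial>lborel)"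
    using dens by (intro nn_integral_mono) (auto split: split_indicator)
  also have "\<dots> = emeasure (offdiag_law (1/2) (1/2) t) {a..b}"
    by (rule emeasure_offdiag_law(1)[symmetric]) simp
  also have "\<dots> = ennreal (measure (offdiag_law (1/2) (1/2) t) {a..b})" by (rule emeasure_eq_measure)
  finally show ?thesis by (simp add: ennreal_le_iff)
qed

lemma nn_integral_inverse_square_atLeast:
  assumes "x > 0"
  shows "(\<integral>\<^sup>+s. ennreal (1 / s\<^sup>2) * indicator {x..} s \<partial>lborel) = ennreal (1 / x)"
proof -
  have "(\<integral>\<^sup>+s. ennreal (1 / s\<^sup>2) * indicator {x..} s \<partial>lborel) = ennreal (0 - (- 1 / x))"
  proof (rule nn_integral_FTC_atLeast)
    show "((\<lambda>x. - 1 / x :: real) \<longlongrightarrow> 0) at_top" by real_asymp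
    show "DERIV (\<lambda>x. - 1 / x) s :> 1 / s\<^sup>2" if "x \<le> s" for s
      using that assms by (auto intro!: derivative_eq_intros simp: power2_eq_square)
  qed auto
  then show ?thesis by simp
qed

lemma nn_integral_exp_inverse:
  assumes k: "k > (0 :: real)"
  shows "(\<integral>\<^sup>+r. ennreal (1 / r\<^sup>2 * exp (- k * (1 / r - 1))) * indicator {0<..<1} r \<partial>lborel) = ennreal (1 / k)"
proof -
  \<comment> \<open>The antiderivative. The value 0 at the left end is its limit there; with 1/0 = 0
    the bare formula would give exp(k)/k.\<close>
  define F where "F r = (if r \<le> 0 then 0 else exp (- k * (1 / r - 1)) / k)" for r
  have ev: "eventually (\<lambda>r. r \<in> {0<..}) (nhds x)" if "x > 0" for x :: real
    using that by (intro eventually_nhds_in_open) auto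
  have "((\<lambda>r. 1 / r\<^sup>2 * exp (- k * (1 / r - 1))) has_integral (F 1 - F 0)) {0..1}"
  proof (rule fundamental_theorem_of_calculus_interior)
    have lim: "((\<lambda>r. exp (- k * (1 / r - 1)) / k) \<longlongrightarrow> 0) (at_right 0)"
      using k by real_asymp
    show "continuous_on {0..1} F"
    proof (rule continuous_on_IccI)
      show "(F \<longlongrightarrow> F 0) (at_right 0)"
      proof -
        have "eventually (\<lambda>r. exp (- k * (1 / r - 1)) / k = F r) (at_right 0)"
          by (auto simp: eventually_at_filter F_def)
        with lim have "(F \<longlongrightarrow> 0) (at_right 0)" by (rule Lim_transform_eventually)
        then show ?thesis by (simp add: F_def)
      qed
      have c: "isCont F x" if "x > 0" for x
      proof -
        have "isCont (\<lambda>r. exp (- k * (1 / r - 1)) / k) x" using that k by (intro continuous_intros) auto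
        moreover have "eventually (\<lambda>r. F r = exp (- k * (1 / r - 1)) / k) (nhds x)"
          using ev[OF that] by (rule eventually_mono) (simp add: F_def)
        ultimately show ?thesis by (simp add: isCont_cong)
      qed
      show "(F \<longlongrightarrow> F 1) (at_left 1)" using c[of 1] by (simp add: isCont_def filterlim_at_split)
      show "F \<midarrow>x\<rightarrow> F x" if "0 < x" for x using c[OF that] by (simp add: isCont_def)
    qed simp
    fix x :: real assume x: "x \<in> {0<..<1}"
    have "((\<lambda>r. exp (- k * (1 / r - 1)) / k) has_real_derivative 1 / x\<^sup>2 * exp (- k * (1 / x - 1))) (at x)"
      using x k by (auto intro!: derivative_eq_intros simp: power2_eq_square field_simps)
    moreover have "eventually (\<lambda>r. exp (- k * (1 / r - 1)) / k = F r) (nhds x)"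
    proof -
      have "x > 0" using x by simp
      from ev[OF this] show ?thesis by (rule eventually_mono) (simp add: F_def)
    qed
    ultimately have "(F has_real_derivative 1 / x\<^sup>2 * exp (- k * (1 / x - 1))) (at x)"
      by (subst (asm) DERIV_cong_ev[OF refl _ refl]) auto
    then show "(F has_vector_derivative 1 / x\<^sup>2 * exp (- k * (1 / x - 1))) (at x)"
      by (simp add: has_real_derivative_iff_has_vector_derivative)
  qed simp
  then have "((\<lambda>r. 1 / r\<^sup>2 * exp (- k * (1 / r - 1))) has_integral 1 / k) {0<..<1}"
    by (simp add: has_integral_Icc_iff_Ioo F_def)
  then have "((\<lambda>r. if r \<in> {0<..<1} then 1 / r\<^sup>2 * exp (- k * (1 / r - 1)) else 0) has_integral 1 / k) UNIV"
    by (simp only: has_integral_restrict_UNIV)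
  then have "(\<integral>\<^sup>+r. ennreal (if r \<in> {0<..<1} then 1 / r\<^sup>2 * exp (- k * (1 / r - 1)) else 0) \<partial>lborel) =
      ennreal (1 / k)"
    by (intro nn_integral_has_integral_lborel) auto
  moreover have "ennreal (if r \<in> {0<..<1} then 1 / r\<^sup>2 * exp (- k * (1 / r - 1)) else 0) =
      ennreal (1 / r\<^sup>2 * exp (- k * (1 / r - 1))) * indicator {0<..<1} r" for r :: real
    by (auto split: split_indicator)
  ultimately show ?thesis by (simp only:)
qed

text \<open>Only the complement is estimated, so the behaviour of the marginal density near 0 does
  not matter: away from 0 it is at most of order |t|/s^2, and the two tails together have mass of
  order |t|/x.\<close>

lemma measure_offdiag_law_near_0_ge:
  assumes t: "t \<noteq> 0" and x: "x > 0"
  shows "1 - 2 * \<bar>t\<bar> / x \<le> measure (offdiag_law (1/2) (1/2) t) {-x..x}"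
proof -
  interpret prob_space "offdiag_law (1/2) (1/2) t" by (rule prob_space_offdiag_law[OF t])
  have sets: "sets (offdiag_law (1/2) (1/2) t) = sets borel" by (simp add: offdiag_law_def)
  define c where "c = 1 / (pi * sqrt (2 * pi) * \<bar>t\<bar>)"
  have c: "c > 0" using t by (simp add: c_def)
  have dens: "(\<integral>\<^sup>+r. ennreal (joint_dens t r s) \<partial>lborel) \<le> ennreal (2 * c * t\<^sup>2) * ennreal (1 / s\<^sup>2)" if s: "s \<noteq> 0" for s
  proof -
    define k where "k = s\<^sup>2 / (2 * t\<^sup>2)"
    have k: "k > 0" using s t by (simp add: k_def)
    have "ennreal (joint_dens t r s) \<le>
      ennreal c * (ennreal (1 / r\<^sup>2 * exp (- k * (1 / r - 1))) * indicator {0<..<1} r)" for r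
    proof (cases "0 < r \<and> r < 1")
      case True
      then have "1 / r \<le> 1 / r\<^sup>2" by (simp add: power2_eq_square field_simps)
      \<comment> \<open>enlarging $1/r$ to $1/r^2$ turns the integrand into an exact derivative\<close>
      then have "c * (1 / r * exp (- k * (1 / r - 1))) \<le> c * (1 / r\<^sup>2 * exp (- k * (1 / r - 1)))"
        using c by (intro mult_left_mono mult_right_mono) auto
      moreover have "joint_dens t r s = c * (1 / r * exp (- k * (1 / r - 1)))"
        unfolding c_def k_def using True t by (subst joint_dens_eq) (auto simp only: mult.assoc)
      ultimately have "joint_dens t r s \<le> c * (1 / r\<^sup>2 * exp (- k * (1 / r - 1)))" by simp
      then show ?thesis using True c by (simp add: ennreal_mult[symmetric] ennreal_leI)
    qed (auto simp: joint_dens_def beta_density_def)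
    then have "(\<integral>\<^sup>+r. ennreal (joint_dens t r s) \<partial>lborel) \<le>
      (\<integral>\<^sup>+r. ennreal c * (ennreal (1 / r\<^sup>2 * exp (- k * (1 / r - 1))) * indicator {0<..<1} r) \<partial>lborel)"
      by (intro nn_integral_mono)
    also have "\<dots> = ennreal c *
        (\<integral>\<^sup>+r. ennreal (1 / r\<^sup>2 * exp (- k * (1 / r - 1))) * indicator {0<..<1} r \<partial>lborel)"
      by (rule nn_integral_cmult) measurable
    also have "(\<integral>\<^sup>+r. ennreal (1 / r\<^sup>2 * exp (- k * (1 / r - 1))) * indicator {0<..<1} r \<partial>lborel) = ennreal (1 / k)"
      by (rule nn_integral_exp_inverse[OF k])
    also have "ennreal c * ennreal (1 / k) = ennreal (c * (1 / k))"
      using c k by (intro ennreal_mult[symmetric]) auto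
    also have "c * (1 / k) = 2 * c * t\<^sup>2 * (1 / s\<^sup>2)" by (simp add: k_def)
    also have "ennreal \<dots> = ennreal (2 * c * t\<^sup>2) * ennreal (1 / s\<^sup>2)"
      using c by (intro ennreal_mult) auto
    finally show ?thesis .
  qed
  \<comment> \<open>The bound for the right tail; the left tail is its reflection.\<close>
  let ?g = "\<lambda>s. ennreal (2 * c * t\<^sup>2) * (ennreal (1 / s\<^sup>2) * indicator {x..} s)"
  have int: "(\<integral>\<^sup>+s. ?g s \<partial>lborel) = ennreal (2 * c * t\<^sup>2 * (1 / x))"
    using c x by (subst nn_integral_cmult) (simp_all add: nn_integral_inverse_square_atLeast ennreal_mult[symmetric])
  have "emeasure (offdiag_law (1/2) (1/2) t) (- {-x..x}) =
    (\<integral>\<^sup>+s. (\<integral>\<^sup>+r. ennreal (joint_dens t r s) \<partial>lborel) * indicator (- {-x..x}) s \<partial>lborel)"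
    by (rule emeasure_offdiag_law(1)) simp
  also have "\<dots> \<le> (\<integral>\<^sup>+s. ?g s + ?g (- s) \<partial>lborel)"
    using dens x by (intro nn_integral_mono) (auto split: split_indicator simp: mult.assoc)
  also have "\<dots> = (\<integral>\<^sup>+s. ?g s \<partial>lborel) + (\<integral>\<^sup>+s. ?g (- s) \<partial>lborel)"
    by (intro nn_integral_add) auto
  also have "(\<integral>\<^sup>+s. ?g (- s) \<partial>lborel) = (\<integral>\<^sup>+s. ?g s \<partial>lborel)"
    using nn_integral_real_affine[of ?g "-1" 0] by simp
  also have "(\<integral>\<^sup>+s. ?g s \<partial>lborel) + (\<integral>\<^sup>+s. ?g s \<partial>lborel) = ennreal (4 * c * t\<^sup>2 / x)"
    unfolding int using c x by (simp add: ennreal_plus[symmetric] del: ennreal_plus)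
  finally have "measure (offdiag_law (1/2) (1/2) t) (- {-x..x}) \<le> 4 * c * t\<^sup>2 / x"
    using c x by (simp add: emeasure_eq_measure ennreal_le_iff)
  also have "\<dots> \<le> 2 * \<bar>t\<bar> / x"
  proof -
    have "3 * 2 \<le> pi * sqrt (2 * pi)" using sqrt_two_pi_bounds pi_gt3 by (intro mult_mono) auto
    then have "4 / (pi * sqrt (2 * pi)) \<le> 2" by (simp add: divide_le_eq)
    then have "4 / (pi * sqrt (2 * pi)) * \<bar>t\<bar> / x \<le> 2 * \<bar>t\<bar> / x"
      using x by (intro divide_right_mono mult_right_mono) auto
    moreover have "4 * c * t\<^sup>2 = 4 / (pi * sqrt (2 * pi)) * \<bar>t\<bar>"
      using t by (simp add: c_def power2_eq_square field_simps abs_if)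
    ultimately show ?thesis by simp
  qed
  finally have "measure (offdiag_law (1/2) (1/2) t) (- {-x..x}) \<le> 2 * \<bar>t\<bar> / x" .
  moreover have "measure (offdiag_law (1/2) (1/2) t) (- {-x..x}) = 1 - measure (offdiag_law (1/2) (1/2) t) {-x..x}"
    using prob_compl[of "{-x..x}"] sets sets_eq_imp_space_eq[OF sets] by (simp add: Compl_eq_Diff_UNIV)
  ultimately show ?thesis by simp
qed

section \<open>The prior mass of a box\<close>

definition unit_fun :: "nat \<Rightarrow> nat \<Rightarrow> real" where
  "unit_fun i j = (if j = i then 1 else 0)"

lemma dot_unit_fun: "i < p \<Longrightarrow> dot p (unit_fun i) w = w i"
  unfolding dot_def unit_fun_def by (simp add: if_distrib[of "\<lambda>x. x * _"] cong: if_cong)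

lemma mv_unit_fun: "j < p \<Longrightarrow> mv p A (unit_fun j) i = A $$ (i, j)"
  unfolding mv_def unit_fun_def by (simp add: if_distrib[of "\<lambda>x. _ * x"] cong: if_cong)

lemma diag_entry_bounds:
  assumes "i < p" and "\<And>v. m * nsq p v \<le> qf p A v" and "\<And>v. qf p A v \<le> M * nsq p v"
  shows "m \<le> A $$ (i, i)" "A $$ (i, i) \<le> M"
proof -
  have "qf p A (unit_fun i) = A $$ (i, i)"
    using \<open>i < p\<close> by (simp add: qf_eq_dot dot_unit_fun mv_unit_fun)
  moreover have "nsq p (unit_fun i) = 1"
    using \<open>i < p\<close> by (simp add: nsq_eq_dot dot_unit_fun) (simp add: unit_fun_def)
  ultimately show "m \<le> A $$ (i, i)" "A $$ (i, i) \<le> M"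
    using assms(2,3)[of "unit_fun i"] by simp_all
qed

text \<open>The form is nonnegative at the sum and at the difference of two unit vectors, so an
  entry is bounded by the mean of two diagonal entries.\<close>

lemma abs_entry_le:
  assumes pd: "pos_def_mat p A" and ij: "i < p" "j < p" and M: "\<And>v. qf p A v \<le> M * nsq p v"
  shows "\<bar>A $$ (i, j)\<bar> \<le> M"
proof -
  have nn: "qf p A v \<ge> 0" for v
  proof (cases "\<exists>i<p. v i \<noteq> 0")
    case True
    then show ?thesis using pd by (auto simp: pos_def_mat_iff_qf less_imp_le)
  next
    case False
    then show ?thesis by (simp add: qf_def)
  qed
  have sym: "A $$ (j, i) = A $$ (i, j)" using pd ij by (simp add: pos_def_mat_iff_qf)
  have "qf p A (\<lambda>k. unit_fun i k + s * unit_fun j k) =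
      A $$ (i, i) + 2 * s * A $$ (i, j) + s\<^sup>2 * A $$ (j, j)" for s
    using ij sym by (simp add: qf_eq_dot dot_simps dot_unit_fun mv_unit_fun power2_eq_square algebra_simps)
  from this[of 1] this[of "-1"] nn[of "\<lambda>k. unit_fun i k + 1 * unit_fun j k"]
    nn[of "\<lambda>k. unit_fun i k + -1 * unit_fun j k"]
  have "2 * \<bar>A $$ (i, j)\<bar> \<le> A $$ (i, i) + A $$ (j, j)" by (simp add: abs_if)
  moreover have "A $$ (i, i) \<le> M" "A $$ (j, j) \<le> M"
    using diag_entry_bounds(2)[where m = 0 and M = M and A = A] ij nn M by auto
  ultimately show ?thesis by linarith
qed

lemma prod_if_const: "finite A \<Longrightarrow> (\<Prod>x\<in>A. if P x then c else 1 :: real) = c ^ card {x \<in> A. P x}"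
  by (simp add: prod.If_cases Int_def)

text \<open>The numbers of zero and nonzero entries are only bounded above, which suffices because
  their factors are at most 1; the number of diagonal factors is exact, so \<open>d\<close> may
  exceed 1. \<open>supp_size\<close> counts ordered pairs and thus generously covers the pairs above
  the diagonal.\<close>

lemma prod_upper_pairs_ge:
  fixes d u g :: real
  assumes S0: "S0 \<in> carrier_mat p p" and d: "0 \<le> d" and u: "0 \<le> u" "u \<le> 1" and g: "0 \<le> g" "g \<le> 1"
    and supp: "supp_size S0 \<le> s0"
  shows "d ^ p * (1 - u) ^ (p\<^sup>2) * g ^ s0 \<le>
    (\<Prod>(j, k)\<in>upper_pairs p. if j = k then d else if S0 $$ (j, k) = 0 then 1 - u else g)"
proof -
  have fin: "finite (upper_pairs p)"
    by (rule finite_subset[of _ "{..<p} \<times> {..<p}"]) auto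
  let ?P1 = "\<lambda>(j, k). j = k" and ?P2 = "\<lambda>(j, k). j \<noteq> k \<and> S0 $$ (j, k) = 0"
    and ?P3 = "\<lambda>(j, k). j \<noteq> k \<and> S0 $$ (j, k) \<noteq> 0"
  have "(\<Prod>(j, k)\<in>upper_pairs p. if j = k then d else if S0 $$ (j, k) = 0 then 1 - u else g) =
    (\<Prod>x\<in>upper_pairs p. (if ?P1 x then d else 1) * (if ?P2 x then 1 - u else 1) * (if ?P3 x then g else 1))"
    by (intro prod.cong) auto
  also have "\<dots> = d ^ card {x \<in> upper_pairs p. ?P1 x} * (1 - u) ^ card {x \<in> upper_pairs p. ?P2 x} *
      g ^ card {x \<in> upper_pairs p. ?P3 x}"
    by (simp only: prod.distrib prod_if_const[OF fin])
  also have "card {x \<in> upper_pairs p. ?P1 x} = p"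
  proof -
    have "{x \<in> upper_pairs p. ?P1 x} = (\<lambda>i. (i, i)) ` {..<p}" by auto
    then show ?thesis by (simp add: card_image inj_on_def)
  qed
  finally have eq: "(\<Prod>(j, k)\<in>upper_pairs p. if j = k then d else if S0 $$ (j, k) = 0 then 1 - u else g) =
      d ^ p * (1 - u) ^ card {x \<in> upper_pairs p. ?P2 x} * g ^ card {x \<in> upper_pairs p. ?P3 x}" .
  have "card {x \<in> upper_pairs p. ?P2 x} \<le> card ({..<p} \<times> {..<p})"
    by (intro card_mono) auto
  then have c2: "card {x \<in> upper_pairs p. ?P2 x} \<le> p\<^sup>2" by (simp add: power2_eq_square)
  have "card {x \<in> upper_pairs p. ?P3 x} \<le> supp_size S0"
    unfolding supp_size_def using S0
    by (intro card_mono finite_subset[of "{(i, j). _ i j}" "{..<p} \<times> {..<p}"]) auto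
  then have c3: "card {x \<in> upper_pairs p. ?P3 x} \<le> s0" using supp by simp
  show ?thesis
    unfolding eq using d u g
    by (intro mult_mono[OF mult_left_mono[OF power_decreasing[OF c2]] power_decreasing[OF c3]]) auto
qed

lemma prior_prob_ge_powers:
  fixes n p s0 :: nat
  assumes \<tau>0: "\<tau>0 > 1" "\<tau>0 < \<tau>" and p: "p > 0" and pn: "p \<le> n" and S0: "S0 \<in> U_sparse p s0 \<tau>0"
    and gap: "1 / (4 * \<tau>0\<^sup>2 * sqrt n) \<le> 1 - \<tau>0 / \<tau>" and \<epsilon>: "real p / real n < \<epsilon>\<^sup>2"
    and lam: "lam > 0" and t: "t \<noteq> 0" "t\<^sup>2 \<le> 1 / 2"
    and rd: "rd = 1 / (8 * \<tau>0 ^ 3 * sqrt n)" and ro: "ro = 1 / (8 * \<tau>0 ^ 3 * (p * sqrt n))"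
    and u: "2 * \<bar>t\<bar> / ro \<le> 1"
  shows "(rd * (lam / 2 * exp (- (\<tau>0 * lam / 2)))) ^ p * (1 - 2 * \<bar>t\<bar> / ro) ^ (p\<^sup>2) *
      (2 * ro * (\<bar>t\<bar> / (32 * (\<tau>0 + 1)\<^sup>2))) ^ s0
    \<le> prior_prob p \<tau> (1/2) (1/2) t lam (B_eps p S0 \<epsilon>)"
proof -
  have n: "n > 0" using p pn by simp
  have pd0: "pos_def_mat p S0" and supp: "supp_size S0 \<le> s0"
    and ev: "1 / \<tau>0 \<le> lambda_min S0" "lambda_max S0 \<le> \<tau>0"
    using S0 by (auto simp: U_sparse_def)
  note sym0 = pos_def_mat_sym_on[OF pd0]
  have S0c: "S0 \<in> carrier_mat p p" using pd0 by (rule pos_def_mat_carrier)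
  have lower: "1 / \<tau>0 * nsq p v \<le> qf p S0 v" and upper: "qf p S0 v \<le> \<tau>0 * nsq p v" for v
    using ev lambda_min_ge_iff[OF sym0 p] lambda_max_le_iff[OF sym0 p] by blast+
  have t3: "\<tau>0 ^ 3 \<ge> 1" "\<tau>0 ^ 3 \<ge> \<tau>0" using \<tau>0 self_le_power[of \<tau>0 3] by (auto intro: one_le_power)
  have sn: "sqrt n \<ge> 1" using n by simp
  have rd0: "rd > 0" and ro0: "ro > 0" using \<tau>0 n p by (simp_all add: rd ro)
  have rd1: "rd \<le> 1 / \<tau>0"
  proof -
    have "\<tau>0 \<le> 8 * \<tau>0 ^ 3 * 1" using t3 \<tau>0 by simp
    also have "\<dots> \<le> 8 * \<tau>0 ^ 3 * sqrt n" using t3 sn \<tau>0 by (intro mult_left_mono) auto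
    finally show ?thesis unfolding rd using \<tau>0 n by (intro divide_left_mono) auto
  qed
  have ro1: "ro \<le> 1"
  proof -
    have "real p * sqrt n \<ge> 1 * 1" using p sn by (intro mult_mono) auto
    then have "(8 * \<tau>0 ^ 3) * (real p * sqrt n) \<ge> 1 * 1" using t3 \<tau>0 by (intro mult_mono) auto
    then show ?thesis unfolding ro by (subst divide_le_eq_1_pos) linarith+
  qed
  have diag: "1 / \<tau>0 \<le> S0 $$ (j, j)" "S0 $$ (j, j) \<le> \<tau>0" if "j < p" for j
    using diag_entry_bounds[OF that lower upper] .
  have off: "\<bar>S0 $$ (j, k)\<bar> \<le> \<tau>0" if "j < p" "k < p" for j k
    using abs_entry_le[OF pd0 that upper] .
  \<comment> \<open>The diagonal interval lies to the left of the true entry, so the decreasing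
    density is at least its value at that entry, which is at most \<tau>0; it stays in the half-line
    of nonnegative numbers because rd \<le> 1/\<tau>0.\<close>
  define X :: "nat \<times> nat \<Rightarrow> real set" where
    "X = (\<lambda>(j, k). if j = k then {S0 $$ (j, j) - rd..S0 $$ (j, j)}
      else if S0 $$ (j, k) = 0 then {- ro..ro} else {S0 $$ (j, k) - ro..S0 $$ (j, k) + ro})"
  define d where "d = rd * (lam / 2 * exp (- (\<tau>0 * lam / 2)))"
  \<comment> \<open>T = \<tau>0 + 1 encloses all the intervals: true entries are at most \<tau>0 in
    absolute value and ro \<le> 1.\<close>
  define g where "g = 2 * ro * (\<bar>t\<bar> / (32 * (\<tau>0 + 1)\<^sup>2))"
  have t1: "\<bar>t\<bar> \<le> 1"
    using t by (simp add: abs_square_le_1[symmetric])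
  have T: "(\<tau>0 + 1)\<^sup>2 \<ge> 1" using \<tau>0 by (intro one_le_power) simp
  have tT: "t\<^sup>2 \<le> (\<tau>0 + 1)\<^sup>2 / 2" using t T by linarith
  have g1: "g \<le> 1"
  proof -
    have "\<bar>t\<bar> / (32 * (\<tau>0 + 1)\<^sup>2) \<le> 1 / 32" using t1 T by (intro frac_le) auto
    then have "2 * ro * (\<bar>t\<bar> / (32 * (\<tau>0 + 1)\<^sup>2)) \<le> 2 * 1 * (1 / 32)"
      using ro1 ro0 by (intro mult_mono) auto
    then show ?thesis by (simp add: g_def)
  qed
  have "d ^ p * (1 - 2 * \<bar>t\<bar> / ro) ^ (p\<^sup>2) * g ^ s0 \<le>
    (\<Prod>(j, k)\<in>upper_pairs p. if j = k then d else if S0 $$ (j, k) = 0 then 1 - 2 * \<bar>t\<bar> / ro else g)"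
    using rd0 ro0 lam u g1
    by (intro prod_upper_pairs_ge S0c supp) (auto simp: d_def g_def)
  also have "\<dots> \<le> (\<Prod>(j, k)\<in>upper_pairs p.
      measure (if j = k then diag_law lam else offdiag_law (1/2) (1/2) t) (X (j, k)))"
  proof (intro prod_mono)
    fix jk assume "jk \<in> upper_pairs p"
    then obtain j k where jk: "jk = (j, k)" "j \<le> k" "k < p" by auto
    have "d \<le> measure (diag_law lam) (X (j, j))"
    proof -
      have "d \<le> rd * (lam / 2 * exp (- (S0 $$ (j, j) * lam / 2)))"
        unfolding d_def using diag[of j] jk lam rd0 by (intro mult_left_mono) auto
      also have "\<dots> = (S0 $$ (j, j) - (S0 $$ (j, j) - rd)) * (lam / 2 * exp (- (S0 $$ (j, j) * lam / 2)))"
        by simp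
      also have "\<dots> \<le> measure (diag_law lam) {S0 $$ (j, j) - rd..S0 $$ (j, j)}"
        using diag[of j] jk rd0 rd1 by (intro measure_diag_law_ge lam) auto
      finally show ?thesis by (simp add: X_def)
    qed
    moreover have "1 - 2 * \<bar>t\<bar> / ro \<le> measure (offdiag_law (1/2) (1/2) t) (X (j, k))"
      if "j \<noteq> k" "S0 $$ (j, k) = 0"
      using measure_offdiag_law_near_0_ge[OF t(1) ro0] that by (simp add: X_def)
    moreover have "g \<le> measure (offdiag_law (1/2) (1/2) t) (X (j, k))"
      if "j \<noteq> k" "S0 $$ (j, k) \<noteq> 0"
    proof -
      have "g = ((S0 $$ (j, k) + ro) - (S0 $$ (j, k) - ro)) * (\<bar>t\<bar> / (32 * (\<tau>0 + 1)\<^sup>2))"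
        by (simp add: g_def)
      also have "\<dots> \<le> measure (offdiag_law (1/2) (1/2) t) {S0 $$ (j, k) - ro..S0 $$ (j, k) + ro}"
        using off[of j k] jk ro1 ro0 \<tau>0
        by (intro measure_offdiag_law_ge t(1) tT) auto
      finally show ?thesis using that by (simp add: X_def)
    qed
    moreover have "0 \<le> d" "0 \<le> g" "0 \<le> 1 - 2 * \<bar>t\<bar> / ro" using rd0 ro0 lam u by (auto simp: d_def g_def)
    ultimately show "0 \<le> (case jk of (j, k) \<Rightarrow> if j = k then d else if S0 $$ (j, k) = 0 then 1 - 2 * \<bar>t\<bar> / ro else g) \<and>
      (case jk of (j, k) \<Rightarrow> if j = k then d else if S0 $$ (j, k) = 0 then 1 - 2 * \<bar>t\<bar> / ro else g)
      \<le> (case jk of (j, k) \<Rightarrow> measure (if j = k then diag_law lam else offdiag_law (1/2) (1/2) t) (X (j, k)))"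
      unfolding jk(1) by auto
  qed
  also have "\<dots> \<le> prior_prob p \<tau> (1/2) (1/2) t lam (B_eps p S0 \<epsilon>)"
  proof (rule prior_prob_ge_prod[OF p _ pd0 _ prob_space_offdiag_law[OF t(1)]])
    show "\<tau> > 0" using \<tau>0 by simp
    show "prob_space (diag_law lam)"
      unfolding diag_law_def using lam by (intro prob_space_exponential_density) simp
    show "X ij \<in> sets borel" for ij by (cases ij) (auto simp: X_def)
    fix x :: "nat \<times> nat \<Rightarrow> real" assume x: "\<And>ij. ij \<in> upper_pairs p \<Longrightarrow> x ij \<in> X ij"
    have sym: "S0 $$ (j, i) = S0 $$ (i, j)" if "i < p" "j < p" for i j
      using pd0 that by (simp add: pos_def_mat_iff_qf)
    have "near p S0 (sym_mat p x) rd ro"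
      unfolding near_def
    proof (intro allI impI)
      have *: "\<bar>x (i, j) - S0 $$ (i, j)\<bar> \<le> (if i = j then rd else ro)" if "i \<le> j" "j < p" for i j
        using x[of "(i, j)"] that rd0 ro0 by (auto simp: X_def split: if_splits)
      fix i j assume ij: "i < p" "j < p"
      show "\<bar>sym_mat p x $$ (i, j) - S0 $$ (i, j)\<bar> \<le> (if i = j then rd else ro)"
        using *[of i j] *[of j i] sym[OF ij] ij by (auto simp: sym_mat_index)
    qed
    then show "sym_mat p x \<in> B_eps p S0 \<epsilon> \<inter> U_tau p \<tau>"
      unfolding rd ro
      by (intro near_in_B_eps_Int_U_tau[OF pd0 sym_on_sym_mat p n \<tau>0 lower upper _ gap pn \<epsilon>])
  qed
  finally show ?thesis by (simp add: d_def g_def)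
qed

text \<open>The sample size condition gives 1 \<le> sqrt n (1 - \<tau>0/\<tau>) \<tau>^2, which is
  useful only for bounded \<tau>. For \<tau> \<le> 2 \<tau>0 it yields the factor 4 \<tau>0^2;
  beyond that the gap is at least 1/2 by itself.\<close>

lemma spectral_gap_ge:
  fixes n :: nat and L s :: real
  assumes \<tau>0: "\<tau>0 > 1" "\<tau>0 < \<tau>" and n: "n > 0" and L: "L \<ge> 1" and s: "s \<ge> 1"
    and cond: "real n \<ge> s / (1 - \<tau>0 / \<tau>)\<^sup>2 * L / \<tau> ^ 4"
  shows "1 / (4 * \<tau>0\<^sup>2 * sqrt n) \<le> 1 - \<tau>0 / \<tau>"
proof (cases "\<tau> \<le> 2 * \<tau>0")
  case True
  define x where "x = 1 - \<tau>0 / \<tau>"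
  have x: "x > 0" using \<tau>0 by (simp add: x_def)
  have "1 \<le> s * L" using s L mult_mono[of 1 s 1 L] by simp
  also have "s * L \<le> real n * (x\<^sup>2 * \<tau> ^ 4)"
  proof -
    have "s * L / (x\<^sup>2 * \<tau> ^ 4) \<le> real n" using cond by (simp add: x_def)
    moreover have "x\<^sup>2 * \<tau> ^ 4 > 0" using x \<tau>0 by simp
    ultimately show ?thesis by (simp only: pos_divide_le_eq)
  qed
  also have "\<dots> = (sqrt n * x * \<tau>\<^sup>2)\<^sup>2"
    by (simp add: power_mult_distrib)
  finally have "1\<^sup>2 \<le> (sqrt n * x * \<tau>\<^sup>2)\<^sup>2" by simp
  then have "1 \<le> sqrt n * x * \<tau>\<^sup>2"
    by (rule power2_le_imp_le) (use x in simp)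
  also have "\<dots> \<le> sqrt n * x * (2 * \<tau>0)\<^sup>2"
    using True x \<tau>0 by (intro mult_left_mono power_mono) auto
  finally have "1 \<le> x * (4 * \<tau>0\<^sup>2 * sqrt n)" by (simp add: power_mult_distrib mult_ac)
  moreover have "4 * \<tau>0\<^sup>2 * sqrt n > 0" using \<tau>0 n by simp
  ultimately show ?thesis unfolding x_def[symmetric] by (simp only: pos_divide_le_eq)
next
  case False
  have "\<tau>0\<^sup>2 * sqrt n \<ge> 1 * 1" using \<tau>0 n by (intro mult_mono one_le_power) auto
  then have "2 \<le> 4 * (\<tau>0\<^sup>2 * sqrt n)" by linarith
  then have "2 \<le> 4 * \<tau>0\<^sup>2 * sqrt n" by (simp only: mult.assoc)
  then have "1 / (4 * \<tau>0\<^sup>2 * sqrt n) \<le> 1 / 2" by (intro frac_le) auto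
  also have "\<dots> \<le> 1 - \<tau>0 / \<tau>" using False \<tau>0 by (simp add: field_simps)
  finally show ?thesis .
qed

section \<open>Asymptotics\<close>

lemma exp_minus_nat_add_mult_ln:
  fixes x b :: real
  assumes "x > 0"
  shows "exp (- ((real k + b) * ln x)) = 1 / (x ^ k * x powr b)"
proof -
  have "exp (- ((real k + b) * ln x)) = 1 / (exp (real k * ln x) * exp (b * ln x))"
    by (simp only: exp_minus exp_add distrib_right inverse_eq_divide)
  also have "exp (real k * ln x) = x ^ k" using assms by (simp add: exp_of_nat_mult)
  also have "exp (b * ln x) = x powr b" using assms by (simp add: powr_def)
  finally show ?thesis .
qed

text \<open>For u \<le> 1/2 the second-order term of ln (1 - u) is absorbed: -u - 2 u^2 \<ge> -2
  u.\<close>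

lemma one_minus_power_ge_exp:
  fixes u :: real
  assumes "0 \<le> u" "u \<le> 1/2"
  shows "exp (- (2 * u * real m)) \<le> (1 - u) ^ m"
proof -
  have "- u - 2 * u\<^sup>2 \<le> ln (1 - u)" using assms by (rule ln_one_minus_pos_lower_bound)
  moreover have "2 * u\<^sup>2 \<le> u" using assms mult_left_mono[of u "1/2" u] by (simp add: power2_eq_square)
  ultimately have "exp (- (2 * u)) \<le> exp (ln (1 - u))" by simp
  then have "exp (- (2 * u)) \<le> 1 - u" using assms by simp
  then have "exp (- (2 * u)) ^ m \<le> (1 - u) ^ m" by (intro power_mono) auto
  then show ?thesis by (simp add: exp_of_nat_mult[symmetric] mult_ac)
qed

text \<open>The statement for one fixed n. The conditions \<open>B1\<close> to \<open>B4\<close> say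
  how large p must be for the constants to be absorbed: \<open>B1\<close> on the diagonal,
  \<open>B2\<close> for nonzero entries, \<open>B3\<close> for zero entries, and \<open>B4\<close>
  to make t^2 \<le> 1/2.\<close>

lemma prior_prob_lower_bound:
  fixes n p s0 :: nat
  assumes \<tau>0: "\<tau>0 > 1" "\<tau>0 < \<tau>" and s0: "s0 > 0" and n: "n > 0" and pn: "p \<le> n"
    and L: "ln (real p) \<ge> 1" and S0: "\<Sigma>0 \<in> U_sparse p s0 \<tau>0" and \<tau>4: "\<tau> ^ 4 \<le> real p"
    and cond: "real n \<ge> s0 / (1 - \<tau>0 / \<tau>)\<^sup>2 * ln (real p) / \<tau> ^ 4"
    and lam: "1 / real p < lam" "lam < ln (real p) / \<tau>0"
    and \<beta>: "\<beta> > 0" and K: "K > 0" "real n \<le> K * real p powr (1 / \<beta>)"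
    and c: "c > 0" "c / (real n * real p ^ 4 * \<tau>\<^sup>2) \<le> t\<^sup>2" and C: "t\<^sup>2 \<le> C / (real n * real p ^ 4 * \<tau>\<^sup>2)"
    and B1: "16 * \<tau>0 ^ 3 * K \<le> real p" and B2: "128 * \<tau>0 ^ 3 * (\<tau>0 + 1)\<^sup>2 * K / sqrt c \<le> real p"
    and B3: "32 * \<tau>0 ^ 3 * sqrt C \<le> ln (real p)" and B4: "2 * C \<le> real p"
    and \<epsilon>: "\<epsilon>\<^sup>2 = (real p + real s0) * ln (real p) / real n"
  shows "exp (- (5 + 1 / \<beta>) * real n * \<epsilon>\<^sup>2) \<le> prior_prob p \<tau> (1/2) (1/2) t lam (B_eps p \<Sigma>0 \<epsilon>)"
proof -
  define P where "P = real p"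
  define N where "N = real n"
  define R where "R = P powr (1 / \<beta>)"
  define rd where "rd = 1 / (8 * \<tau>0 ^ 3 * sqrt n)"
  define ro where "ro = 1 / (8 * \<tau>0 ^ 3 * (p * sqrt n))"
  define d where "d = rd * (lam / 2 * exp (- (\<tau>0 * lam / 2)))"
  define u where "u = 2 * \<bar>t\<bar> / ro"
  define g where "g = 2 * ro * (\<bar>t\<bar> / (32 * (\<tau>0 + 1)\<^sup>2))"
  have p: "p > 0" using L by (cases p) auto
  have N1: "N \<ge> 1" using n by (simp add: N_def)
  have lnP: "ln P \<le> P - 1" using p by (intro ln_le_minus_one) (simp add: P_def)
  have P1: "P \<ge> 2" using lnP L by (simp add: P_def)
  have R1: "R > 0" using P1 by (simp add: R_def)
  have NK: "N \<le> K * R" using K by (simp add: N_def R_def P_def)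
  have sN: "sqrt N > 0" "sqrt N \<le> N" "sqrt N * sqrt N = N"
    using N1 by (auto intro: real_le_lsqrt simp: power2_eq_square)
  have t3: "\<tau>0 ^ 3 > 0" using \<tau>0 by simp
  have rd': "rd = 1 / (8 * \<tau>0 ^ 3 * sqrt N)" and ro': "ro = 1 / (8 * \<tau>0 ^ 3 * (P * sqrt N))"
    by (simp_all add: rd_def ro_def N_def P_def)
  have rd0: "rd > 0" and ro0: "ro > 0" using t3 sN P1 by (simp_all add: rd' ro')
  have tau: "1 \<le> \<tau>" "\<tau> \<le> P"
  proof -
    show "1 \<le> \<tau>" using \<tau>0 by simp
    then have "\<tau> \<le> \<tau> ^ 4" by (intro self_le_power) auto
    then show "\<tau> \<le> P" using \<tau>4 by (simp add: P_def)
  qed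
  have lam0: "lam > 0" using lam(1) P1 by (auto simp: P_def intro: less_trans[rotated])
  have den: "N * P ^ 4 * \<tau>\<^sup>2 > 0" using N1 P1 tau by simp
  have t0: "t \<noteq> 0"
  proof
    assume "t = 0"
    then have "c / (N * P ^ 4 * \<tau>\<^sup>2) \<le> 0" using c by (simp add: N_def P_def)
    with c(1) den show False by (simp add: divide_le_0_iff)
  qed
  have C0: "C > 0"
  proof -
    have "0 < t\<^sup>2" using t0 by simp
    also have "\<dots> \<le> C / (N * P ^ 4 * \<tau>\<^sup>2)" using C by (simp add: N_def P_def)
    finally show ?thesis using den by (simp add: zero_less_divide_iff)
  qed
  have root_den: "sqrt (N * P ^ 4 * \<tau>\<^sup>2) = sqrt N * P\<^sup>2 * \<tau>"
  proof -
    have "P ^ 4 = (P\<^sup>2)\<^sup>2" by simp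
    then show ?thesis using P1 tau by (simp only: real_sqrt_mult real_sqrt_abs) simp
  qed
  have tl: "sqrt c / (sqrt N * P\<^sup>2 * \<tau>) \<le> \<bar>t\<bar>"
    using real_sqrt_le_mono[OF c(2)] unfolding N_def[symmetric] P_def[symmetric] real_sqrt_divide root_den
    by simp
  have tu: "\<bar>t\<bar> \<le> sqrt C / (sqrt N * P\<^sup>2 * \<tau>)"
    using real_sqrt_le_mono[OF C] unfolding N_def[symmetric] P_def[symmetric] real_sqrt_divide root_den
    by simp
  have t2: "t\<^sup>2 \<le> 1 / 2"
  proof -
    have "N * P ^ 4 * \<tau>\<^sup>2 \<ge> 1 * P * 1"
      using N1 P1 tau self_le_power[of P 4] by (intro mult_mono one_le_power) auto
    then have "C / (N * P ^ 4 * \<tau>\<^sup>2) \<le> C / P" using C0 P1 by (intro divide_left_mono) auto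
    also have "\<dots> \<le> 1 / 2" using B4 P1 by (simp add: P_def field_simps)
    finally show ?thesis using C unfolding N_def P_def by (rule order_trans[rotated])
  qed
  have uC: "u \<le> 16 * \<tau>0 ^ 3 * sqrt C / P"
  proof -
    have "u = 16 * \<tau>0 ^ 3 * P * sqrt N * \<bar>t\<bar>" by (simp add: u_def ro')
    also have "\<dots> \<le> 16 * \<tau>0 ^ 3 * P * sqrt N * (sqrt C / (sqrt N * P\<^sup>2 * \<tau>))"
      using t3 P1 sN by (intro mult_left_mono tu) auto
    also have "\<dots> = 16 * \<tau>0 ^ 3 * sqrt C / P / \<tau>"
      using P1 sN by (simp add: power2_eq_square)
    also have "\<dots> \<le> 16 * \<tau>0 ^ 3 * sqrt C / P / 1"
      using tau t3 C0 P1 by (intro divide_left_mono) auto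
    finally show ?thesis by simp
  qed
  \<comment> \<open>Since u is of order 1/p, the p^2 factors 1 - u cost exp(-O(p)); one logarithm is
    spent on the unknown constant, so that the total is at most P ln P.\<close>
  have uL: "2 * u * P \<le> ln P"
  proof -
    have "u * P \<le> 16 * \<tau>0 ^ 3 * sqrt C" using uC P1 by (simp add: pos_le_divide_eq)
    then show ?thesis using B3 by (simp add: P_def)
  qed
  have u0: "u \<ge> 0" using ro0 by (simp add: u_def)
  have u1: "u \<le> 1 / 2"
  proof -
    have "2 * u * P \<le> 1 * P" using uL lnP by simp
    then have "2 * u \<le> 1" using P1 by (subst (asm) mult_le_cancel_right_pos) auto
    then show ?thesis by simp
  qed
  \<comment> \<open>The factors are rd \<ge> 1/(8 \<tau>0^3 n), lam \<ge> 1/p, and exp(-\<tau>0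
    lam/2) \<ge> 1/p from the upper bound on \<open>lam\<close>. Two powers of p remain for the
    constants.\<close>
  have d_ge: "exp (- ((4 + 1 / \<beta>) * ln P)) \<le> d"
  proof -
    have "exp (- ln P) \<le> exp (- (\<tau>0 * lam / 2))"
    proof -
      have "\<tau>0 * lam \<le> ln P" using lam(2) \<tau>0 by (simp add: P_def pos_less_divide_eq mult.commute)
      moreover have "0 \<le> ln P" using L by (simp add: P_def)
      ultimately show ?thesis by simp
    qed
    then have e: "1 / P \<le> exp (- (\<tau>0 * lam / 2))" using P1 by (simp add: exp_minus inverse_eq_divide)
    have "exp (- ((4 + 1 / \<beta>) * ln P)) = 1 / (P ^ 4 * R)"
      using P1 exp_minus_nat_add_mult_ln[of P 4 "1 / \<beta>"] by (simp add: R_def)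
    also have "\<dots> \<le> 1 / (16 * \<tau>0 ^ 3 * (K * R) * P\<^sup>2)"
    proof (rule divide_left_mono)
      have "16 * \<tau>0 ^ 3 * K * (R * P\<^sup>2) \<le> P\<^sup>2 * (R * P\<^sup>2)"
      proof (rule mult_right_mono)
        have "P \<le> P\<^sup>2" using P1 by (intro self_le_power) auto
        then show "16 * \<tau>0 ^ 3 * K \<le> P\<^sup>2" using B1 unfolding P_def by linarith
      qed (use R1 in simp)
      also have "\<dots> = P ^ 4 * R" by (simp add: power2_eq_square power4_eq_xxxx)
      finally show "16 * \<tau>0 ^ 3 * (K * R) * P\<^sup>2 \<le> P ^ 4 * R" by (simp add: mult_ac)
    qed (use t3 K R1 P1 in auto)
    also have "\<dots> \<le> 1 / (16 * \<tau>0 ^ 3 * sqrt N * P\<^sup>2)"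
      using NK sN t3 P1 K R1 by (intro divide_left_mono mult_right_mono mult_left_mono) auto
    also have "\<dots> = rd * (1 / P / 2 * (1 / P))" by (simp add: rd' power2_eq_square)
    also have "\<dots> \<le> d"
      unfolding d_def using e lam(1) rd0 P1 lam0
      by (intro mult_left_mono mult_mono) (auto simp: P_def)
    finally show ?thesis .
  qed
  \<comment> \<open>Here \<tau> \<le> p is used, which turns the lower bound on |t| into order
    1/(sqrt n p^3). The two roots of n multiply to n \<le> K R, and the fifth power of p absorbs the
    constants; 128 = 8 * 32 / 2.\<close>
  have g_ge: "exp (- ((5 + 1 / \<beta>) * ln P)) \<le> g"
  proof -
    let ?T = "(\<tau>0 + 1)\<^sup>2"
    have T: "?T > 0" using \<tau>0 by simp
    have "exp (- ((5 + 1 / \<beta>) * ln P)) = 1 / (P ^ 5 * R)"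
      using P1 exp_minus_nat_add_mult_ln[of P 5 "1 / \<beta>"] by (simp add: R_def)
    also have "\<dots> \<le> 1 / (128 * \<tau>0 ^ 3 * ?T / sqrt c * (K * R) * P ^ 4)"
    proof (rule divide_left_mono)
      have "128 * \<tau>0 ^ 3 * ?T * K / sqrt c * (R * P ^ 4) \<le> P * (R * P ^ 4)"
        using B2 R1 by (intro mult_right_mono) (auto simp: P_def)
      also have "\<dots> = P ^ 5 * R" by (simp add: numeral_eq_Suc)
      finally show "128 * \<tau>0 ^ 3 * ?T / sqrt c * (K * R) * P ^ 4 \<le> P ^ 5 * R" by (simp add: mult_ac)
    qed (use t3 T K R1 P1 c in auto)
    also have "\<dots> \<le> 1 / (128 * \<tau>0 ^ 3 * ?T / sqrt c * N * P ^ 4)"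
      using NK N1 t3 T P1 K R1 c by (intro divide_left_mono mult_right_mono mult_left_mono) auto
    also have "\<dots> = 2 * ro * (sqrt c / (sqrt N * P\<^sup>2 * P) / (32 * ?T))"
    proof -
      have "1 / (128 * a * b / s * (w * w) * P ^ 4) = 2 * (1 / (8 * a * (P * w))) * (s / (w * P\<^sup>2 * P) / (32 * b))"
        for a b s w :: real
        by (simp add: power2_eq_square power4_eq_xxxx)
      from this[of "\<tau>0 ^ 3" ?T "sqrt c" "sqrt N"] show ?thesis
        unfolding ro' by (simp only: sN(3))
    qed
    also have "\<dots> \<le> 2 * ro * (sqrt c / (sqrt N * P\<^sup>2 * \<tau>) / (32 * ?T))"
      using tau sN P1 c ro0 T
      by (intro mult_left_mono divide_right_mono divide_left_mono) auto
    also have "\<dots> \<le> g"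
      unfolding g_def using ro0 T by (intro mult_left_mono divide_right_mono tl) auto
    finally show ?thesis .
  qed
  have sq_ge: "exp (- (P * ln P)) \<le> (1 - u) ^ (p\<^sup>2)"
  proof -
    have "2 * u * real (p\<^sup>2) = (2 * u * P) * P" by (simp add: P_def power2_eq_square)
    also have "\<dots> \<le> ln P * P" using uL P1 by (intro mult_right_mono) auto
    finally have "exp (- (P * ln P)) \<le> exp (- (2 * u * real (p\<^sup>2)))" by (simp add: mult.commute)
    also have "\<dots> \<le> (1 - u) ^ (p\<^sup>2)" by (rule one_minus_power_ge_exp[OF u0 u1])
    finally show ?thesis .
  qed
  \<comment> \<open>The budget closes exactly: p (4 + 1/\<beta>) + p + s0 (5 + 1/\<beta>) = (5 +
    1/\<beta>) (p + s0).\<close>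
  have "exp (- (5 + 1 / \<beta>) * real n * \<epsilon>\<^sup>2) =
    exp (- ((4 + 1 / \<beta>) * ln P)) ^ p * exp (- (P * ln P)) * exp (- ((5 + 1 / \<beta>) * ln P)) ^ s0"
  proof -
    have "- (5 + 1 / \<beta>) * real n * \<epsilon>\<^sup>2 = - (5 + 1 / \<beta>) * ((P + real s0) * ln P)"
      using n by (simp add: \<epsilon> P_def)
    also have "\<dots> = P * (- ((4 + 1 / \<beta>) * ln P)) + (- (P * ln P)) + real s0 * (- ((5 + 1 / \<beta>) * ln P))"
      by (simp add: algebra_simps)
    finally show ?thesis by (simp only: exp_add exp_of_nat_mult P_def)
  qed
  also have "\<dots> \<le> d ^ p * (1 - u) ^ (p\<^sup>2) * g ^ s0"
    using d_ge sq_ge g_ge rd0 ro0 lam0 u1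
    by (intro mult_mono power_mono mult_nonneg_nonneg zero_le_power) (auto simp: d_def g_def)
  also have "\<dots> \<le> prior_prob p \<tau> (1/2) (1/2) t lam (B_eps p \<Sigma>0 \<epsilon>)"
    unfolding d_def u_def g_def
  proof (rule prior_prob_ge_powers[OF \<tau>0 p pn S0 _ _ lam0 t0 t2 rd_def ro_def])
    show "1 / (4 * \<tau>0\<^sup>2 * sqrt (real n)) \<le> 1 - \<tau>0 / \<tau>"
      using s0 by (intro spectral_gap_ge[OF \<tau>0 n L _ cond]) auto
    show "real p / real n < \<epsilon>\<^sup>2"
    proof -
      have "P * 1 < (P + real s0) * ln P"
        using s0 L P1 by (intro mult_less_le_imp_less) (auto simp: P_def)
      then show ?thesis using n unfolding \<epsilon> by (simp add: P_def divide_strict_right_mono)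
    qed
    show "2 * \<bar>t\<bar> / ro \<le> 1" using u1 by (simp add: u_def)
  qed
  finally show ?thesis .
qed

theorem theorem5:
  fixes p s0 :: "nat \<Rightarrow> nat"
    and \<tau> \<tau>1 lam :: "nat \<Rightarrow> real"
    and \<tau>0 \<beta> :: real
    and \<Sigma>0 :: "nat \<Rightarrow> real mat"
  assumes "\<tau>0 > 1"
    and "\<forall>n. s0 n > 0"
    and "0 < \<beta>" and "\<beta> < 1"
    and "asymp_eq (\<lambda>n. real (p n)) (\<lambda>n. real n powr \<beta>)"
    and "asymp_eq (\<lambda>n. (\<tau>1 n)\<^sup>2) (\<lambda>n. 1 / (real n * real (p n) ^ 4 * (\<tau> n)\<^sup>2))"
    and "eventually (\<lambda>n. \<Sigma>0 n \<in> U_sparse (p n) (s0 n) \<tau>0) sequentially"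
    and "eventually (\<lambda>n. \<tau>0 < \<tau> n) sequentially"
    and "eventually (\<lambda>n. (\<tau> n) ^ 4 \<le> real (p n)) sequentially"
    and "eventually (\<lambda>n. (\<tau> n)\<^sup>2 * \<tau>0\<^sup>2 \<le> real (s0 n) * ln (real (p n))) sequentially"
    and "eventually (\<lambda>n. real n \<ge> max (1 / \<tau>0 ^ 4) (real (s0 n) / (1 - \<tau>0 / \<tau> n)\<^sup>2)
                                  * ln (real (p n)) / (\<tau> n) ^ 4) sequentially"
    and "eventually (\<lambda>n. 1 / real (p n) < lam n \<and> lam n < ln (real (p n)) / \<tau>0) sequentially"
  shows "eventually (\<lambda>n.
           let \<epsilon> = sqrt ((real (p n) + real (s0 n)) * ln (real (p n)) / real n) in
           prior_prob (p n) (\<tau> n) (1/2) (1/2) (\<tau>1 n) (lam n) (B_eps (p n) (\<Sigma>0 n) \<epsilon>)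
             \<ge> exp (- (5 + 1 / \<beta>) * real n * \<epsilon>\<^sup>2)) sequentially"
proof -
  obtain c1 C1 where c1: "c1 > 0"
    and p_asymp: "eventually (\<lambda>n. real n powr \<beta> \<noteq> 0 \<and> c1 \<le> real (p n) / real n powr \<beta> \<and>
      real (p n) / real n powr \<beta> \<le> C1) sequentially"
    using assms(5) unfolding asymp_eq_def by blast
  obtain c C where c: "c > 0"
    and t_asymp: "eventually (\<lambda>n. 1 / (real n * real (p n) ^ 4 * (\<tau> n)\<^sup>2) \<noteq> 0 \<and>
      c \<le> (\<tau>1 n)\<^sup>2 / (1 / (real n * real (p n) ^ 4 * (\<tau> n)\<^sup>2)) \<and>
      (\<tau>1 n)\<^sup>2 / (1 / (real n * real (p n) ^ 4 * (\<tau> n)\<^sup>2)) \<le> C) sequentially"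
    using assms(6) unfolding asymp_eq_def by blast
  \<comment> \<open>Solving c1 n^\<beta> \<le> p for n gives n \<le> K p^(1/\<beta>), the source of
    1/\<beta> in the rate.\<close>
  define K where "K = (1 / c1) powr (1 / \<beta>)"
  have K: "K > 0" using c1 by (simp add: K_def)
  have p_top: "filterlim (\<lambda>n. real (p n)) at_top sequentially"
  proof (rule filterlim_at_top_mono)
    show "filterlim (\<lambda>n. c1 * real n powr \<beta>) at_top sequentially"
      using c1 assms(3) by real_asymp
    show "eventually (\<lambda>n. c1 * real n powr \<beta> \<le> real (p n)) sequentially"
      using p_asymp
    proof eventually_elim
      case (elim n)
      then have pos: "real n powr \<beta> > 0" by simp
      from elim have "c1 \<le> real (p n) / real n powr \<beta>" by blast
      then show ?case by (simp only: pos_le_divide_eq[OF pos])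
    qed
  qed
  then have p_ge: "eventually (\<lambda>n. B \<le> real (p n)) sequentially" for B
    by (simp add: filterlim_at_top)
  have ln_ge: "eventually (\<lambda>n. B \<le> ln (real (p n))) sequentially" for B
    using filterlim_compose[OF ln_at_top p_top] by (simp add: filterlim_at_top)
  \<comment> \<open>This is where \<beta> < 1 enters: eventually p \<le> n, as the Bernoulli
    estimate requires.\<close>
  have n_ge: "eventually (\<lambda>n. C1 * real n powr \<beta> \<le> real n) sequentially"
    using assms(3,4) by real_asymp
  show ?thesis
    using p_asymp t_asymp assms(7-9) assms(11,12) n_ge ln_ge[of 1] ln_ge[of "32 * \<tau>0 ^ 3 * sqrt C"]
      p_ge[of "16 * \<tau>0 ^ 3 * K"] p_ge[of "128 * \<tau>0 ^ 3 * (\<tau>0 + 1)\<^sup>2 * K / sqrt c"] p_ge[of "2 * C"]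
      eventually_gt_at_top[of 0]
  proof eventually_elim
    case (elim n)
    let ?D = "real n * real (p n) ^ 4 * (\<tau> n)\<^sup>2"
    let ?\<epsilon> = "sqrt ((real (p n) + real (s0 n)) * ln (real (p n)) / real n)"
    have npos: "real n powr \<beta> > 0" using elim by simp
    have "real n \<le> K * real (p n) powr (1 / \<beta>)"
    proof -
      have "real n powr \<beta> \<le> 1 / c1 * real (p n)"
      proof -
        from elim(1) have "c1 \<le> real (p n) / real n powr \<beta>" by blast
        then have "c1 * real n powr \<beta> \<le> real (p n)" by (simp only: pos_le_divide_eq[OF npos])
        then show ?thesis using c1 by (simp add: field_simps)
      qed
      then have "(real n powr \<beta>) powr (1 / \<beta>) \<le> (1 / c1 * real (p n)) powr (1 / \<beta>)"
        using assms(3) by (intro powr_mono2) auto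
      also have "\<dots> = K * real (p n) powr (1 / \<beta>)" unfolding K_def by (rule powr_mult)
      finally show ?thesis using assms(3) by (simp add: powr_powr)
    qed
    moreover have "p n \<le> n"
    proof -
      from elim(1) have "real (p n) / real n powr \<beta> \<le> C1" by blast
      then have "real (p n) \<le> C1 * real n powr \<beta>" by (simp only: pos_divide_le_eq[OF npos])
      then show ?thesis using elim by simp
    qed
    moreover have "c / ?D \<le> (\<tau>1 n)\<^sup>2" "(\<tau>1 n)\<^sup>2 \<le> C / ?D"
    proof -
      \<comment> \<open>A zero denominator would make the reference sequence 1/D equal to 0, which
        \<open>asymp_eq\<close> excludes.\<close>
      have "?D \<noteq> 0" using elim(2) by auto
      moreover have "?D \<ge> 0" by simp
      ultimately have "?D > 0" by linarith
      then show "c / ?D \<le> (\<tau>1 n)\<^sup>2" "(\<tau>1 n)\<^sup>2 \<le> C / ?D"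
        using elim(2) by (simp_all only: pos_divide_le_eq pos_le_divide_eq divide_divide_eq_right div_by_1)
    qed
    moreover have "real (s0 n) / (1 - \<tau>0 / \<tau> n)\<^sup>2 * ln (real (p n)) / \<tau> n ^ 4 \<le> real n"
    proof -
      have "real (s0 n) / (1 - \<tau>0 / \<tau> n)\<^sup>2 * ln (real (p n)) / \<tau> n ^ 4 \<le>
        max (1 / \<tau>0 ^ 4) (real (s0 n) / (1 - \<tau>0 / \<tau> n)\<^sup>2) * ln (real (p n)) / \<tau> n ^ 4"
        using elim by (intro divide_right_mono mult_right_mono) auto
      then show ?thesis using elim by linarith
    qed
    moreover have "?\<epsilon>\<^sup>2 = (real (p n) + real (s0 n)) * ln (real (p n)) / real n"
      using elim by (intro real_sqrt_pow2 divide_nonneg_nonneg mult_nonneg_nonneg) auto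
    ultimately show ?case
      unfolding Let_def using elim assms(1-3) K c
      by (intro prior_prob_lower_bound[where K = K and c = c and C = C]) auto
  qed
qed

end
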